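(* Let $\varphi=\varphi(t)$ be the Kuranishi data of a holomorphic family $\pi:\mathfrak{X}\to\Delta$ of compact complex manifolds with central fiber $X_0$ and nearby fibers $X_t$ ($t$ small). For every $\omega\in A^{p,0}(X_0)$, \begin{align*} d\big(e^{i_{\varphi}|i_{\overline{\varphi}}}(\omega)\big)=e^{i_{\varphi}|i_{\overline{\varphi}}}\Big(&(\mathbf{1}-\overline{\varphi}\varphi)^{-1}\lrcorner\big(\overline{\partial}\omega+\partial(\varphi\lrcorner\omega)-\varphi\lrcorner\partial\omega\big)\\ &+(\mathbf{1}-\varphi\overline{\varphi})^{-1}\lrcorner\partial\omega-p\,\partial\omega-\big((\mathbf{1}-\varphi\overline{\varphi})^{-1}\lrcorner\overline{\varphi}\big)\lrcorner\big(\overline{\partial}\omega+\partial(\varphi\lrcorner\omega)\big)\Big). \end{align*}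
   Context: Setting. $\pi:\mathfrak{X}\to\Delta$ is a holomorphic family of $n$-dimensional compact complex manifolds over a small disk $\Delta\subset\mathbb{C}$, with central fiber $X_0$ and fibers $X_t=\pi^{-1}(t)$. A transversely holomorphic trivialization $\mathfrak{X}\cong X_0\times\Delta$ is fixed, by which $X_t$ is identified with $X_0$ as a smooth manifold. It yields the Kuranishi data $\varphi=\varphi(t)\in A^{0,1}(X_0,T^{1,0}_{X_0})$, depending holomorphically on $t$, with $\varphi(0)=0$ and $\overline{\partial}\varphi=\frac12[\varphi,\varphi]$, where for $\phi=\sum\phi^i\otimes\partial/\partial z^i$, $\psi=\sum\psi^i\otimes\partial/\partial z^i$ in $A^{0,1}(X_0,T^{1,0}_{X_0})$ one has $[\phi,\psi]=\sum_{i,j}(\phi^i\wedge\partial_i\psi^j+\psi^i\wedge\partial_i\phi^j)\otimes\partial/\partial z^j$. In local holomorphic coordinates $z$ on $X_0$, write $\varphi=\sum\varphi^i_{\bar k}\,d\bar z^k\otimes\partial/\partial z^i$; the forms $e^{i_\varphi}(dz^i)=dz^i+\varphi^i_{\bar k}d\bar z^k$ are a local frame of $T^{*(1,0)}_{X_t}$ and their conjugates a local frame of $T^{*(0,1)}_{X_t}$. $t$ is small enough that the inverses below exist. $A^{p,q}$ denotes smooth complex $(p,q)$-forms; $\partial,\overline{\partial}$ are those of $X_0$; $d$ is the exterior derivative. Contraction. For a vector-valued form $\eta\otimes v$ ($\eta$ a form, $v$ a complex vector field), $(\eta\otimes v)\lrcorner\alpha=\eta\wedge(v\lrcorner\alpha)$,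 extended linearly (so contraction with a vector-valued $1$-form is a derivation of degree $0$; e.g. contracting an $(r,0)$-form with the identity $\sum dz^i\otimes\partial/\partial z^i$ multiplies it by $r$); $i_\varphi=\varphi\lrcorner$. If $\alpha$ is itself a vector-valued form, contraction acts on its form part. Exponentials. $e^{i_\varphi}=\sum_{k\ge0}\frac1{k!}i_\varphi^k$, and similarly $e^{i_{\overline{\varphi}}}$. The map $e^{i_{\varphi}|i_{\overline{\varphi}}}:A^{p,q}(X_0)\to A^{p,q}(X_t)$ sends $\omega=\sum\frac1{p!q!}\omega_{i_1\cdots i_p;j_1\cdots j_q}dz^{i_1}\wedge\cdots\wedge dz^{i_p}\wedge d\bar z^{j_1}\wedge\cdots\wedge d\bar z^{j_q}$ to $\sum\frac1{p!q!}\omega_{i_1\cdots i_p;j_1\cdots j_q}\,e^{i_\varphi}(dz^{i_1}\wedge\cdots\wedge dz^{i_p})\wedge e^{i_{\overline{\varphi}}}(d\bar z^{j_1}\wedge\cdots\wedge d\bar z^{j_q})$; it is extended additively to sums of forms of different types. Products. $\overline{\varphi}\varphi:=\varphi\lrcorner\overline{\varphi}=\sum\overline{\varphi}^{\bar i}_{k}\varphi^k_{\bar l}\,d\bar z^l\otimes\partial/\partial\bar z^i$ and $\varphi\overline{\varphi}:=\overline{\varphi}\lrcorner\varphi=\sum\varphi^i_{\bar k}\overline{\varphi}^{\bar k}_{l}\,dz^l\otimes\partial/\partial z^i$. $\mathbf{1}$ is the identity (of $T^{0,1}_{X_0}$ next to $\overline{\varphi}\varphi$, of $T^{1,0}_{X_0}$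 next to $\varphi\overline{\varphi}$); inverses are taken as endomorphisms, and the results are regarded as vector-valued $1$-forms. *)

theory Defs
  imports "HOL-Analysis.Analysis"
begin

type_synonym 'n cvec = "(complex, 'n) vec"

section \<open>Exterior algebra of the complexified cotangent space\<close>

text \<open>
  At a point with holomorphic coordinates \<open>z\<^sup>i\<close> the complexified cotangent space has the basis
  \<open>dx\<^sup>a\<close> with \<open>dx (Inl i) = dz\<^sup>i\<close> and \<open>dx (Inr i)\<close> the conjugate of \<open>dz\<^sup>i\<close>.
  An element of the exterior algebra is given by its coefficients on the basis indexed by sets of
  indices: \<open>axis S 1\<close> is the wedge product of the \<open>dx\<^sup>a\<close>, \<open>a \<in> S\<close>, in increasing order
  (all \<open>Inl\<close> before all \<open>Inr\<close>).
\<close>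

type_synonym 'n ext = "(complex, ('n + 'n) set) vec"

fun index_less :: "'n::linorder + 'n \<Rightarrow> 'n + 'n \<Rightarrow> bool" where
  "index_less (Inl i) (Inl j) \<longleftrightarrow> i < j"
| "index_less (Inl i) (Inr j) \<longleftrightarrow> True"
| "index_less (Inr i) (Inl j) \<longleftrightarrow> False"
| "index_less (Inr i) (Inr j) \<longleftrightarrow> i < j"

definition index_list :: "('n::{finite,linorder} + 'n) set \<Rightarrow> ('n + 'n) list" where
  "index_list S = map Inl (sorted_list_of_set {i. Inl i \<in> S})
                @ map Inr (sorted_list_of_set {i. Inr i \<in> S})"

definition shuffle_sign :: "('n::{finite,linorder} + 'n) set \<Rightarrow> ('n + 'n) set \<Rightarrow> complex" where
  "shuffle_sign S T = (- 1) ^ card {(a, b). a \<in> S \<and> b \<in> T \<and> index_less b a}"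

definition wedge :: "'n::{finite,linorder} ext \<Rightarrow> 'n ext \<Rightarrow> 'n ext" where
  "wedge \<alpha> \<beta> = (\<chi> S. \<Sum>T\<in>Pow S. shuffle_sign T (S - T) * \<alpha> $ T * \<beta> $ (S - T))"

definition ext_one :: "'n::{finite,linorder} ext" where
  "ext_one = axis {} 1"

definition dx :: "'n::{finite,linorder} + 'n \<Rightarrow> 'n ext" where
  "dx a = axis {a} 1"

definition wedge_list :: "'n::{finite,linorder} ext list \<Rightarrow> 'n ext" where
  "wedge_list xs = foldr wedge xs ext_one"

text \<open>The algebra homomorphism with \<open>dx\<^sup>a \<mapsto> \<theta> a\<close>, for \<open>\<theta>\<close> with values in 1-forms.\<close>

definition subst_form :: "('n::{finite,linorder} + 'n \<Rightarrow> 'n ext) \<Rightarrow> 'n ext \<Rightarrow> 'n ext" where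
  "subst_form \<theta> \<alpha> = (\<Sum>S\<in>UNIV. \<alpha> $ S *s wedge_list (map \<theta> (index_list S)))"

definition swap_index :: "'n + 'n \<Rightarrow> 'n + 'n" where
  "swap_index a = (case a of Inl i \<Rightarrow> Inr i | Inr i \<Rightarrow> Inl i)"

definition ext_cnj :: "'n::{finite,linorder} ext \<Rightarrow> 'n ext" where
  "ext_cnj \<alpha> = subst_form (\<lambda>a. dx (swap_index a)) (\<chi> S. cnj (\<alpha> $ S))"

definition of_type :: "nat \<Rightarrow> nat \<Rightarrow> 'n::{finite,linorder} ext \<Rightarrow> bool" where
  "of_type p q \<alpha> \<longleftrightarrow>
     (\<forall>S. \<alpha> $ S \<noteq> 0 \<longrightarrow> card {i. Inl i \<in> S} = p \<and> card {i. Inr i \<in> S} = q)"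

section \<open>Vector-valued forms and contraction\<close>

text \<open>
  \<open>A $ b\<close> is the form coefficient of the basis vector dual to \<open>dx b\<close>, that is of
  \<open>\<partial>/\<partial>z\<^sup>i\<close> for \<open>b = Inl i\<close> and of its conjugate for \<open>b = Inr i\<close>.
\<close>

type_synonym 'n vform = "('n ext, 'n + 'n) vec"

text \<open>Contraction of a form with the basis vector dual to \<open>dx b\<close>.\<close>

definition interior_prod :: "'n::{finite,linorder} + 'n \<Rightarrow> 'n ext \<Rightarrow> 'n ext" where
  "interior_prod b \<alpha> =
     (\<chi> S. if b \<in> S then 0 else shuffle_sign {b} S * \<alpha> $ insert b S)"

definition contract :: "'n::{finite,linorder} vform \<Rightarrow> 'n ext \<Rightarrow> 'n ext" where
  "contract A \<alpha> = (\<Sum>b\<in>UNIV. wedge (A $ b) (interior_prod b \<alpha>))"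

definition vcontract :: "'n::{finite,linorder} vform \<Rightarrow> 'n vform \<Rightarrow> 'n vform" where
  "vcontract A B = (\<chi> b. contract A (B $ b))"

definition vcnj :: "'n::{finite,linorder} vform \<Rightarrow> 'n vform" where
  "vcnj A = (\<chi> b. ext_cnj (A $ swap_index b))"

definition id10 :: "'n::{finite,linorder} vform" where
  "id10 = (\<chi> b. case b of Inl i \<Rightarrow> dx (Inl i) | Inr i \<Rightarrow> 0)"

definition id01 :: "'n::{finite,linorder} vform" where
  "id01 = (\<chi> b. case b of Inl i \<Rightarrow> 0 | Inr i \<Rightarrow> dx (Inr i))"

text \<open>
  Endomorphisms of \<open>T\<^sup>1\<^sup>,\<^sup>0\<close> and of \<open>T\<^sup>0\<^sup>,\<^sup>1\<close> regarded as vector-valued 1-forms, and their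
  matrices (row index: vector, column index: form).
\<close>

definition mat10 :: "'n::{finite,linorder} vform \<Rightarrow> ('n cvec, 'n) vec" where
  "mat10 A = (\<chi> i k. A $ Inl i $ {Inl k})"

definition mat01 :: "'n::{finite,linorder} vform \<Rightarrow> ('n cvec, 'n) vec" where
  "mat01 A = (\<chi> i k. A $ Inr i $ {Inr k})"

definition vform10 :: "('n cvec, 'n) vec \<Rightarrow> 'n::{finite,linorder} vform" where
  "vform10 M = (\<chi> b. case b of Inl i \<Rightarrow> (\<Sum>k\<in>UNIV. M $ i $ k *s dx (Inl k)) | Inr i \<Rightarrow> 0)"

definition vform01 :: "('n cvec, 'n) vec \<Rightarrow> 'n::{finite,linorder} vform" where
  "vform01 M = (\<chi> b. case b of Inl i \<Rightarrow> 0 | Inr i \<Rightarrow> (\<Sum>k\<in>UNIV. M $ i $ k *s dx (Inr k)))"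

definition inv10 :: "'n::{finite,linorder} vform \<Rightarrow> 'n vform" where
  "inv10 A = vform10 (matrix_inv (mat10 A))"

definition inv01 :: "'n::{finite,linorder} vform \<Rightarrow> 'n vform" where
  "inv01 A = vform01 (matrix_inv (mat01 A))"

definition exp_contract :: "'n::{finite,linorder} vform \<Rightarrow> 'n ext \<Rightarrow> 'n ext" where
  "exp_contract A \<alpha> = (\<Sum>k. (1 / fact k) *\<^sub>R (contract A ^^ k) \<alpha>)"

text \<open>
  The extension map \<open>exp(i\<^sub>\<phi> | i\<^sub>\<psi>)\<close>, \<open>\<psi>\<close> the conjugate of \<open>\<phi>\<close>. Every basis element
  \<open>axis S 1\<close> is the product of its \<open>dz\<close>-part and its conjugate part without a sign, so the sum
  over \<open>S\<close> is the sum over increasing multi-indices and needs no factor \<open>1/(p!q!)\<close>.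
\<close>

definition ext_map :: "'n::{finite,linorder} vform \<Rightarrow> 'n ext \<Rightarrow> 'n ext" where
  "ext_map A \<alpha> =
     (\<Sum>S\<in>UNIV. \<alpha> $ S *s wedge (exp_contract A (axis (S \<inter> range Inl) 1))
                               (exp_contract (vcnj A) (axis (S \<inter> range Inr) 1)))"

section \<open>Differential operators in holomorphic coordinates\<close>

definition wirtinger :: "'n::finite + 'n \<Rightarrow> ('n cvec \<Rightarrow> complex) \<Rightarrow> 'n cvec \<Rightarrow> complex" where
  "wirtinger a f z =
     (case a of
        Inl i \<Rightarrow> (frechet_derivative f (at z) (axis i 1)
                 - \<i> * frechet_derivative f (at z) (axis i \<i>)) / 2
      | Inr i \<Rightarrow> (frechet_derivative f (at z) (axis i 1)
                 + \<i> * frechet_derivative f (at z) (axis i \<i>)) / 2)"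

definition dfun :: "('n cvec \<Rightarrow> complex) \<Rightarrow> 'n cvec \<Rightarrow> 'n::{finite,linorder} ext" where
  "dfun f z = (\<Sum>a\<in>UNIV. wirtinger a f z *s dx a)"

text \<open>Derivative of the coefficients of a form.\<close>

definition partial_form ::
    "'n + 'n \<Rightarrow> ('n cvec \<Rightarrow> 'n ext) \<Rightarrow> 'n cvec \<Rightarrow> 'n::{finite,linorder} ext" where
  "partial_form a \<alpha> z = (\<chi> S. wirtinger a (\<lambda>w. \<alpha> w $ S) z)"

definition ext_d :: "('n cvec \<Rightarrow> 'n ext) \<Rightarrow> 'n cvec \<Rightarrow> 'n::{finite,linorder} ext" where
  "ext_d \<alpha> z = (\<Sum>a\<in>UNIV. wedge (dx a) (partial_form a \<alpha> z))"

definition del :: "('n cvec \<Rightarrow> 'n ext) \<Rightarrow> 'n cvec \<Rightarrow> 'n::{finite,linorder} ext" where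
  "del \<alpha> z = (\<Sum>i\<in>UNIV. wedge (dx (Inl i)) (partial_form (Inl i) \<alpha> z))"

definition delbar :: "('n cvec \<Rightarrow> 'n ext) \<Rightarrow> 'n cvec \<Rightarrow> 'n::{finite,linorder} ext" where
  "delbar \<alpha> z = (\<Sum>i\<in>UNIV. wedge (dx (Inr i)) (partial_form (Inr i) \<alpha> z))"

definition vdelbar ::
    "('n cvec \<Rightarrow> 'n vform) \<Rightarrow> 'n cvec \<Rightarrow> 'n::{finite,linorder} vform" where
  "vdelbar \<Phi> z = (\<chi> b. delbar (\<lambda>w. \<Phi> w $ b) z)"

text \<open>For \<open>T\<^sup>1\<^sup>,\<^sup>0\<close>-valued (0,1)-forms, whose \<open>Inr\<close> components vanish.\<close>

definition bracket :: "('n cvec \<Rightarrow> 'n vform) \<Rightarrow> ('n cvec \<Rightarrow> 'n vform) \<Rightarrow>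
    'n cvec \<Rightarrow> 'n::{finite,linorder} vform" where
  "bracket \<Phi> \<Psi> z =
     (\<chi> b. case b of
        Inl j \<Rightarrow> (\<Sum>i\<in>UNIV.
            wedge (\<Phi> z $ Inl i) (partial_form (Inl i) (\<lambda>w. \<Psi> w $ Inl j) z)
          + wedge (\<Psi> z $ Inl i) (partial_form (Inl i) (\<lambda>w. \<Phi> w $ Inl j) z))
      | Inr j \<Rightarrow> 0)"

section \<open>Smooth and holomorphic functions\<close>

primrec Ck_on :: "nat \<Rightarrow> 'a::euclidean_space set \<Rightarrow> ('a \<Rightarrow> 'b::euclidean_space) \<Rightarrow> bool" where
  "Ck_on 0 S f \<longleftrightarrow> continuous_on S f"
| "Ck_on (Suc k) S f \<longleftrightarrow>
     (\<forall>x\<in>S. f differentiable (at x)) \<and>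
     (\<forall>v. Ck_on k S (\<lambda>x. frechet_derivative f (at x) v))"

text \<open>Only used for open \<open>S\<close>.\<close>

definition smooth_on :: "'a::euclidean_space set \<Rightarrow> ('a \<Rightarrow> 'b::euclidean_space) \<Rightarrow> bool" where
  "smooth_on S f \<longleftrightarrow> (\<forall>k. Ck_on k S f)"

definition holo_fun_on :: "'n::finite cvec set \<Rightarrow> ('n cvec \<Rightarrow> complex) \<Rightarrow> bool" where
  "holo_fun_on S f \<longleftrightarrow>
     (\<forall>z\<in>S. \<exists>f'. (f has_derivative f') (at z) \<and> (\<forall>c v. f' (c *s v) = c * f' v))"

definition holo_map_on :: "'n::finite cvec set \<Rightarrow> ('n cvec \<Rightarrow> 'm::finite cvec) \<Rightarrow> bool" where
  "holo_map_on S f \<longleftrightarrow> (\<forall>j. holo_fun_on S (\<lambda>z. f z $ j))"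

section \<open>Charts and complex manifolds\<close>

text \<open>A chart \<open>(U, f)\<close> consists of its domain and the coordinate map.\<close>

type_synonym ('x, 'e) chart = "'x set \<times> ('x \<Rightarrow> 'e)"

definition chart_range :: "('x, 'e) chart \<Rightarrow> 'e set" where
  "chart_range c = snd c ` fst c"

definition chart_inv :: "('x, 'e) chart \<Rightarrow> 'e \<Rightarrow> 'x" where
  "chart_inv c = inv_into (fst c) (snd c)"

definition top_chart :: "'x topology \<Rightarrow> ('x, 'e::euclidean_space) chart \<Rightarrow> bool" where
  "top_chart M c \<longleftrightarrow> openin M (fst c) \<and> open (chart_range c) \<and>
     homeomorphic_map (subtopology M (fst c)) (top_of_set (chart_range c)) (snd c)"

definition transition :: "('x, 'e) chart \<Rightarrow> ('x, 'f) chart \<Rightarrow> 'e \<Rightarrow> 'f" where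
  "transition c c' = snd c' \<circ> chart_inv c"

definition complex_manifold :: "'x topology \<Rightarrow> ('x, 'm::finite cvec) chart set \<Rightarrow> bool" where
  "complex_manifold M A \<longleftrightarrow>
     Hausdorff_space M \<and> second_countable M \<and>
     (\<forall>c\<in>A. top_chart M c) \<and> (\<Union>c\<in>A. fst c) = topspace M \<and>
     (\<forall>c\<in>A. \<forall>c'\<in>A. holo_map_on (snd c ` (fst c \<inter> fst c')) (transition c c'))"

definition smooth_map :: "'x topology \<Rightarrow> ('x, 'e::euclidean_space) chart set \<Rightarrow>
    'y topology \<Rightarrow> ('y, 'f::euclidean_space) chart set \<Rightarrow> ('x \<Rightarrow> 'y) \<Rightarrow> bool" where
  "smooth_map M A N B F \<longleftrightarrow> continuous_map M N F \<and>
     (\<forall>c\<in>A. \<forall>c'\<in>B. smooth_on (snd c ` (fst c \<inter> F -` fst c')) (snd c' \<circ> F \<circ> chart_inv c))"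

definition prod_charts ::
    "('x, 'e) chart set \<Rightarrow> complex set \<Rightarrow> ('x \<times> complex, 'e \<times> complex) chart set" where
  "prod_charts A D = (\<lambda>c. (fst c \<times> D, \<lambda>(x, t). (snd c x, t))) ` A"

section \<open>Differential forms on a complex manifold\<close>

text \<open>
  A form on a manifold with a set \<open>C\<close> of holomorphic charts is the family of its coordinate
  expressions, one for each chart, on the coordinate domains \<open>chart_range c\<close>; the members are related
  by pullback along the transition maps. The operators of the preceding sections act chart by chart,
  and two forms are equal if their expressions agree on \<open>chart_range c\<close> for all \<open>c \<in> C\<close>.
\<close>

type_synonym ('x, 'n) form = "('x, 'n cvec) chart \<Rightarrow> 'n cvec \<Rightarrow> 'n ext"
type_synonym ('x, 'n) vector_form = "('x, 'n cvec) chart \<Rightarrow> 'n cvec \<Rightarrow> 'n vform"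

definition coord :: "'n::finite + 'n \<Rightarrow> 'n cvec \<Rightarrow> complex" where
  "coord b z = (case b of Inl i \<Rightarrow> z $ i | Inr i \<Rightarrow> cnj (z $ i))"

definition pullback ::
    "('n cvec \<Rightarrow> 'n cvec) \<Rightarrow> 'n cvec \<Rightarrow> 'n::{finite,linorder} ext \<Rightarrow> 'n ext" where
  "pullback T z = subst_form (\<lambda>b. dfun (\<lambda>w. coord b (T w)) z)"

definition forms ::
    "('x, 'n cvec) chart set \<Rightarrow> nat \<Rightarrow> nat \<Rightarrow> ('x, 'n::{finite,linorder}) form set" where
  "forms C p q = {\<omega>. \<forall>c\<in>C.
     smooth_on (chart_range c) (\<omega> c) \<and>
     (\<forall>z\<in>chart_range c. of_type p q (\<omega> c z)) \<and>
     (\<forall>c'\<in>C. \<forall>x\<in>fst c \<inter> fst c'.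
        \<omega> c (snd c x) = pullback (transition c c') (snd c x) (\<omega> c' (snd c' x)))}"

text \<open>
  The space of smooth (0,1)-forms with values in \<open>T\<^sup>1\<^sup>,\<^sup>0\<close>. In the transformation law the form parts
  are pulled back and the vector parts transform with the Jacobian matrix.
\<close>

definition beltrami_forms ::
    "('x, 'n cvec) chart set \<Rightarrow> ('x, 'n::{finite,linorder}) vector_form set" where
  "beltrami_forms C = {\<Phi>. \<forall>c\<in>C.
     smooth_on (chart_range c) (\<Phi> c) \<and>
     (\<forall>z\<in>chart_range c. \<forall>i. of_type 0 1 (\<Phi> c z $ Inl i) \<and> \<Phi> c z $ Inr i = 0) \<and>
     (\<forall>c'\<in>C. \<forall>x\<in>fst c \<inter> fst c'. \<forall>b.
        pullback (transition c c') (snd c x) (\<Phi> c' (snd c' x) $ b) =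
        (\<Sum>a\<in>UNIV. wirtinger a (\<lambda>w. coord b (transition c c' w)) (snd c x)
                      *s (\<Phi> c (snd c x) $ a)))}"

section \<open>Holomorphic families and Kuranishi data\<close>

definition fibre :: "'x topology \<Rightarrow> ('x \<Rightarrow> complex) \<Rightarrow> complex \<Rightarrow> 'x topology" where
  "fibre X \<pi> t = subtopology X {x. \<pi> x = t}"

text \<open>
  The holomorphic charts of the fibre over \<open>t\<close> as a complex submanifold of the total space: charts
  whose inverse is a holomorphic immersion into the total space.
\<close>

definition fibre_charts :: "'x topology \<Rightarrow> ('x, 'm::finite cvec) chart set \<Rightarrow>
    ('x \<Rightarrow> complex) \<Rightarrow> complex \<Rightarrow> ('x, 'n::finite cvec) chart set" where
  "fibre_charts X A \<pi> t = {c. top_chart (fibre X \<pi> t) c \<and>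
     (\<forall>c'\<in>A. holo_map_on (snd c ` (fst c \<inter> fst c')) (transition c c') \<and>
        (\<forall>z\<in>snd c ` (fst c \<inter> fst c'). inj (frechet_derivative (transition c c') (at z))))}"

text \<open>
  A holomorphic family \<open>\<pi>\<close> of \<open>n\<close>-dimensional compact complex manifolds over the disk of radius \<open>r\<close>:
  a proper holomorphic submersion. \<open>C t\<close> is the holomorphic atlas of the fibre over \<open>t\<close>.
\<close>

definition holomorphic_family :: "'x topology \<Rightarrow> ('x, 'm::finite cvec) chart set \<Rightarrow>
    ('x \<Rightarrow> complex) \<Rightarrow> real \<Rightarrow> (complex \<Rightarrow> ('x, 'n::finite cvec) chart set) \<Rightarrow> bool" where
  "holomorphic_family X A \<pi> r C \<longleftrightarrow>
     0 < r \<and> CARD('m) = CARD('n) + 1 \<and>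
     complex_manifold X A \<and>
     \<pi> ` topspace X = ball 0 r \<and>
     proper_map X (top_of_set (ball 0 r)) \<pi> \<and>
     (\<forall>c\<in>A. holo_fun_on (chart_range c) (\<pi> \<circ> chart_inv c) \<and>
        (\<forall>z\<in>chart_range c. surj (frechet_derivative (\<pi> \<circ> chart_inv c) (at z)))) \<and>
     (\<forall>t. C t = fibre_charts X A \<pi> t)"

text \<open>
  A transversely holomorphic trivialization, given by the map \<open>F\<close> from the product to the total space:
  a diffeomorphism over the disk which is the identity on the central fibre and holomorphic
  along each \<open>{x} \<times> \<Delta>\<close>.
\<close>

definition transversely_holomorphic_trivialization :: "'x topology \<Rightarrow>
    ('x, 'm::finite cvec) chart set \<Rightarrow> ('x \<Rightarrow> complex) \<Rightarrow> real \<Rightarrow>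
    (complex \<Rightarrow> ('x, 'n::finite cvec) chart set) \<Rightarrow> ('x \<times> complex \<Rightarrow> 'x) \<Rightarrow> bool" where
  "transversely_holomorphic_trivialization X A \<pi> r C F \<longleftrightarrow>
     (let X0 = topspace (fibre X \<pi> 0); \<Delta> = ball 0 r;
          P = prod_topology (fibre X \<pi> 0) (top_of_set \<Delta>)
      in bij_betw F (X0 \<times> \<Delta>) (topspace X) \<and>
         smooth_map P (prod_charts (C 0) \<Delta>) X A F \<and>
         smooth_map X A P (prod_charts (C 0) \<Delta>) (inv_into (X0 \<times> \<Delta>) F) \<and>
         (\<forall>x\<in>X0. \<forall>t\<in>\<Delta>. \<pi> (F (x, t)) = t) \<and>
         (\<forall>x\<in>X0. F (x, 0) = x) \<and>
         (\<forall>x\<in>X0. \<forall>c\<in>A. \<forall>j.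
            (\<lambda>t. snd c (F (x, t)) $ j) holomorphic_on {t \<in> \<Delta>. F (x, t) \<in> fst c}))"

text \<open>
  Kuranishi data of a trivialized family. The last condition says that the forms
  \<open>exp(i\<^sub>\<phi>) dz\<^sup>i\<close> are a frame of the (1,0)-covectors of the fibre over \<open>t\<close>, transported to the
  central fibre by \<open>F (_, t)\<close>. These covectors are spanned by the differentials of
  holomorphic coordinates \<open>c'\<close> of that fibre. Both families have \<open>n\<close> linearly independent members, so
  equality of spans suffices.
\<close>

definition kuranishi_data :: "real \<Rightarrow> (complex \<Rightarrow> ('x, 'n cvec) chart set) \<Rightarrow>
    ('x \<times> complex \<Rightarrow> 'x) \<Rightarrow> (complex \<Rightarrow> ('x, 'n::{finite,linorder}) vector_form) \<Rightarrow> bool" where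
  "kuranishi_data r C F \<phi> \<longleftrightarrow>
     (\<forall>t\<in>ball 0 r. \<phi> t \<in> beltrami_forms (C 0)) \<and>
     (\<forall>c\<in>C 0. \<forall>z\<in>chart_range c. \<forall>i k.
        (\<lambda>t. \<phi> t c z $ Inl i $ {Inr k}) holomorphic_on ball 0 r) \<and>
     (\<forall>c\<in>C 0. \<forall>z\<in>chart_range c. \<phi> 0 c z = 0) \<and>
     (\<forall>t\<in>ball 0 r. \<forall>c\<in>C 0. \<forall>z\<in>chart_range c.
        vdelbar (\<phi> t c) z = (1 / 2) *\<^sub>R bracket (\<phi> t c) (\<phi> t c) z) \<and>
     (\<forall>t\<in>ball 0 r. \<forall>c\<in>C 0. \<forall>c'\<in>C t. \<forall>x\<in>fst c. F (x, t) \<in> fst c' \<longrightarrow>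
        vec.span (range (\<lambda>i. exp_contract (\<phi> t c (snd c x)) (dx (Inl i)))) =
        vec.span (range (\<lambda>j. dfun (\<lambda>z. snd c' (F (chart_inv c z, t)) $ j) (snd c x))))"

end

theory Submission
  imports Defs
begin

text \<open>
  In a chart, \<open>exp(i\<^sub>\<phi>)\<close> is a finite sum, maps \<open>dz\<^sup>i\<close> to \<open>dz\<^sup>i + \<phi>\<^sup>i\<close> and fixes the
  conjugate differentials. As \<open>i\<^sub>\<phi>\<close> commutes with its derivative,
  \<open>\<partial>\<^sub>a (exp(i\<^sub>\<phi>) \<omega>) = exp(i\<^sub>\<phi>) (\<partial>\<^sub>a \<omega> + (\<partial>\<^sub>a \<phi>) \<lrcorner> \<omega>)\<close>, and integrability of \<open>\<phi>\<close> cancels the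
  quadratic terms, so that \<open>d (exp(i\<^sub>\<phi>) \<omega>)\<close> is \<open>exp(i\<^sub>\<phi>)\<close> of
  \<open>d\<omega> + \<partial>(\<phi> \<lrcorner> \<omega>) - \<phi> \<lrcorner> \<partial>\<omega>\<close>, a form of type \<open>(p+1,0) + (p,1)\<close>. Let \<open>P\<close> be the matrix of
  \<open>\<phi>\<close>, \<open>R\<close> its conjugate, \<open>N = (1 - RP)\<^sup>-\<^sup>1\<close> and \<open>M = (1 - PR)\<^sup>-\<^sup>1\<close>. On forms of type
  \<open>(p+1,0)\<close> the extension map agrees with \<open>exp(i\<^sub>\<phi>)\<close>; on those of type \<open>(p,1)\<close> it
  does so after solving for the conjugate differentials in the frame of the nearby fibre, which uses
  \<open>NR = RM\<close> and \<open>N - RMP = 1\<close>. Finally \<open>PRM = M - 1\<close> turns the contraction of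
  \<open>\<phi> \<lrcorner> \<partial>\<omega>\<close> with \<open>RM\<close> into \<open>M \<lrcorner> \<partial>\<omega> - (p+1) \<partial>\<omega>\<close>.
\<close>

section \<open>The exterior algebra\<close>

text \<open>Linearity over the complex numbers; \<open>linear\<close> on these types means linearity
  over the reals.\<close>

abbreviation clinear :: "(complex ^ 'a \<Rightarrow> complex ^ 'b) \<Rightarrow> bool" where
  "clinear \<equiv> Vector_Spaces.linear (*s) (*s)"

lemma clinearI:
  assumes "\<And>x y. f (x + y) = f x + f y" and "\<And>c x. f (c *s x) = c *s f x"
  shows "clinear f"
  by unfold_locales (simp_all add: assms vec.scale_right_distrib vec.scale_left_distrib)

text \<open>A form is determined by its coefficients on the \<open>axis S 1\<close>, so an identity
  of linear maps need only be checked there. Identities in several arguments use this rule once per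
  argument.\<close>

lemma clinear_eqI:
  fixes f g :: "complex ^ 'a::finite \<Rightarrow> complex ^ 'b"
  assumes "clinear f" "clinear g" and "\<And>S. f (axis S 1) = g (axis S 1)"
  shows "f x = g x"
proof -
  have "f x = f (\<Sum>S\<in>UNIV. x $ S *s axis S 1)"
    by (simp only: basis_expansion)
  also have "\<dots> = (\<Sum>S\<in>UNIV. x $ S *s f (axis S 1))"
    by (simp add: vec.linear_sum[OF assms(1)] vec.linear_scale[OF assms(1)])
  also have "\<dots> = g (\<Sum>S\<in>UNIV. x $ S *s axis S 1)"
    by (simp add: vec.linear_sum[OF assms(2)] vec.linear_scale[OF assms(2)] assms(3))
  finally show ?thesis
    by (simp only: basis_expansion)
qed

lemma clinear_wedge_left: "clinear (\<lambda>\<alpha>. wedge \<alpha> \<beta>)"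
  by (rule clinearI)
     (simp_all add: wedge_def vec_eq_iff algebra_simps sum.distrib sum_distrib_left)

lemma clinear_wedge_right: "clinear (wedge \<alpha>)"
  by (rule clinearI)
     (simp_all add: wedge_def vec_eq_iff algebra_simps sum.distrib sum_distrib_left)

lemma clinear_interior: "clinear (interior_prod b)"
  by (rule clinearI) (simp_all add: interior_prod_def vec_eq_iff algebra_simps)

interpretation wedge_left: Vector_Spaces.linear "(*s)" "(*s)" "\<lambda>\<alpha>. wedge \<alpha> \<beta>"
  for \<beta> :: "'n::{finite,linorder} ext"
  by (rule clinear_wedge_left)

interpretation wedge_right: Vector_Spaces.linear "(*s)" "(*s)" "wedge \<alpha>"
  for \<alpha> :: "'n::{finite,linorder} ext"
  by (rule clinear_wedge_right)

interpretation interior: Vector_Spaces.linear "(*s)" "(*s)" "interior_prod b"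
  for b :: "'n::{finite,linorder} + 'n"
  by (rule clinear_interior)

section \<open>Signs of shuffles\<close>

lemma shuffle_sign_union_left:
  assumes "S \<inter> T = {}"
  shows "shuffle_sign (S \<union> T) U = shuffle_sign S U * shuffle_sign T U"
proof -
  have "{(a, b). a \<in> S \<union> T \<and> b \<in> U \<and> index_less b a} =
      {(a, b). a \<in> S \<and> b \<in> U \<and> index_less b a} \<union> {(a, b). a \<in> T \<and> b \<in> U \<and> index_less b a}"
    by auto
  moreover have "{(a, b). a \<in> S \<and> b \<in> U \<and> index_less b a} \<inter>
      {(a, b). a \<in> T \<and> b \<in> U \<and> index_less b a} = {}"
    using assms by auto
  ultimately show ?thesis
    by (simp add: shuffle_sign_def card_Un_disjoint power_add)
qed

lemma shuffle_sign_union_right: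
  assumes "S \<inter> T = {}"
  shows "shuffle_sign U (S \<union> T) = shuffle_sign U S * shuffle_sign U T"
proof -
  have "{(a, b). a \<in> U \<and> b \<in> S \<union> T \<and> index_less b a} =
      {(a, b). a \<in> U \<and> b \<in> S \<and> index_less b a} \<union> {(a, b). a \<in> U \<and> b \<in> T \<and> index_less b a}"
    by auto
  moreover have "{(a, b). a \<in> U \<and> b \<in> S \<and> index_less b a} \<inter>
      {(a, b). a \<in> U \<and> b \<in> T \<and> index_less b a} = {}"
    using assms by auto
  ultimately show ?thesis
    by (simp add: shuffle_sign_def card_Un_disjoint power_add)
qed

lemma shuffle_sign_empty [simp]: "shuffle_sign {} S = 1" "shuffle_sign S {} = 1"
  by (simp_all add: shuffle_sign_def)

lemma shuffle_sign_square [simp]: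
  "shuffle_sign S T * shuffle_sign S T = 1" "shuffle_sign S T * (shuffle_sign S T * c) = c"
  by (simp_all add: shuffle_sign_def flip: power_add mult.assoc)

lemma index_less_total: "a \<noteq> b \<Longrightarrow> index_less a b \<longleftrightarrow> \<not> index_less b a"
  by (cases a; cases b) auto

text \<open>Of the two orders of distinct indices exactly one is an inversion.\<close>

lemma shuffle_sign_singletons:
  assumes "a \<noteq> b"
  shows "shuffle_sign {b} {a} = - shuffle_sign {a} {b}"
proof -
  have sign: "shuffle_sign {c} {d} = (if index_less d c then - 1 else 1)" for c d :: "'a + 'a"
  proof -
    have "{(x, y). x \<in> {c} \<and> y \<in> {d} \<and> index_less y x} = (if index_less d c then {(c, d)} else {})"
      by (cases "index_less d c") auto
    then show ?thesis
      by (simp add: shuffle_sign_def)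
  qed
  show ?thesis
    unfolding sign using index_less_total[OF assms] by (cases "index_less a b") simp_all
qed

lemma shuffle_sign_insert:
  assumes "b \<notin> S"
  shows "shuffle_sign {a} (insert b S) = shuffle_sign {a} {b} * shuffle_sign {a} S"
  using shuffle_sign_union_right[of "{b}" S "{a}"] assms by simp

lemma shuffle_sign_insert_left:
  assumes "b \<notin> S"
  shows "shuffle_sign (insert b S) T = shuffle_sign {b} T * shuffle_sign S T"
  using shuffle_sign_union_left[of "{b}" S T] assms by simp

text \<open>Moving \<open>a\<close> across \<open>S\<close> exchanges it with every element of
  \<open>S\<close>, and each exchange costs a factor \<open>-1\<close>.\<close>

lemma shuffle_sign_swap:
  assumes "a \<notin> S"
  shows "shuffle_sign {a} S = (-1) ^ card S * shuffle_sign S {a}"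
proof -
  have "finite S" by simp
  then show ?thesis using assms
  proof (induction S rule: finite_induct)
    case (insert b S)
    have "shuffle_sign {a} (insert b S) = shuffle_sign {a} {b} * shuffle_sign {a} S"
      using insert.hyps by (intro shuffle_sign_insert)
    also have "shuffle_sign {a} {b} = - shuffle_sign {b} {a}"
      using insert.prems by (intro shuffle_sign_singletons) auto
    also have "shuffle_sign {a} S = (-1) ^ card S * shuffle_sign S {a}"
      using insert.prems by (intro insert.IH) auto
    also have "- shuffle_sign {b} {a} * ((-1) ^ card S * shuffle_sign S {a}) =
        (-1) ^ card (insert b S) * (shuffle_sign {b} {a} * shuffle_sign S {a})"
      using insert.hyps by simp
    also have "shuffle_sign {b} {a} * shuffle_sign S {a} = shuffle_sign (insert b S) {a}"
      using insert.hyps by (intro shuffle_sign_insert_left[symmetric])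
    finally show ?case .
  qed simp
qed

section \<open>Products and interior products of basis elements\<close>

lemma wedge_axis:
  "wedge (axis S 1) (axis T 1) =
    (if S \<inter> T = {} then shuffle_sign S T *s axis (S \<union> T) 1 else 0)"
proof (rule vec_eq_iff[THEN iffD2, rule_format])
  fix U :: "('a + 'a) set"
  \<comment> \<open>Among the subsets \<open>V\<close> of \<open>U\<close> only \<open>V = S\<close>
    can contribute, and then the complement has to be \<open>T\<close>.\<close>
  have "wedge (axis S 1) (axis T 1) $ U =
      (\<Sum>V\<in>Pow U. if V = S then (if U - S = T then shuffle_sign S T else 0) else 0)"
    unfolding wedge_def vec_lambda_beta
    by (rule sum.cong) (auto simp: axis_def)
  also have "\<dots> = (if S \<subseteq> U \<and> U - S = T then shuffle_sign S T else 0)"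
    by (subst sum.delta) auto
  also have "\<dots> = (if S \<inter> T = {} then shuffle_sign S T *s axis (S \<union> T) 1 else 0) $ U"
  proof -
    have "S \<subseteq> U \<and> U - S = T \<longleftrightarrow> S \<inter> T = {} \<and> U = S \<union> T"
      by auto
    then show ?thesis
      by (simp add: axis_def)
  qed
  finally show "wedge (axis S 1) (axis T 1) $ U = \<dots>" .
qed

text \<open>On basis elements both sides carry the product of the signs of the three pairs, and both
  vanish as soon as two of the index sets meet. Linearity extends this to \<open>\<gamma>\<close>,
  \<open>\<beta>\<close> and \<open>\<alpha>\<close> in turn.\<close>

lemma wedge_assoc: "wedge (wedge \<alpha> \<beta>) \<gamma> = wedge \<alpha> (wedge \<beta> \<gamma>)"
proof -
  have A: "wedge (wedge (axis S 1) (axis T 1)) (axis U 1) =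
      wedge (axis S 1) (wedge (axis T 1) (axis U 1))" for S T U :: "('a + 'a) set"
    using shuffle_sign_union_left[of S T U] shuffle_sign_union_right[of T U S]
    by (cases "S \<inter> T = {}"; cases "T \<inter> U = {}"; cases "S \<inter> U = {}")
       (auto simp: wedge_axis wedge_left.scale wedge_right.scale Int_Un_distrib Int_Un_distrib2
          Un_assoc wedge_left.zero wedge_right.zero mult_ac)
  have B: "wedge (wedge (axis S 1) (axis T 1)) \<gamma> = wedge (axis S 1) (wedge (axis T 1) \<gamma>)"
    for S T :: "('a + 'a) set"
    by (rule clinear_eqI[where x = \<gamma>])
       (simp_all add: A clinearI wedge_right.add wedge_right.scale)
  have C: "wedge (wedge (axis S 1) \<beta>) \<gamma> = wedge (axis S 1) (wedge \<beta> \<gamma>)" for S :: "('a + 'a) set"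
    by (rule clinear_eqI[where x = \<beta>])
       (simp_all add: B clinearI wedge_right.add wedge_right.scale wedge_left.add wedge_left.scale)
  show ?thesis
    by (rule clinear_eqI[where x = \<alpha>])
       (simp_all add: C clinearI wedge_right.add wedge_right.scale wedge_left.add wedge_left.scale)
qed

lemma wedge_one [simp]: "wedge ext_one \<alpha> = \<alpha>" "wedge \<alpha> ext_one = \<alpha>"
  by (rule clinear_eqI[where x = \<alpha>];
      simp add: ext_one_def wedge_axis clinear_wedge_left clinear_wedge_right vec.linear_ident)+

lemma interior_axis:
  "interior_prod b (axis S 1) =
    (if b \<in> S then shuffle_sign {b} (S - {b}) *s axis (S - {b}) 1 else 0)"
  by (auto simp: interior_prod_def vec_eq_iff axis_def)

lemma dx_wedge_axis:
  "wedge (dx a) (axis S 1) = (if a \<in> S then 0 else shuffle_sign {a} S *s axis (insert a S) 1)"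
  by (simp add: dx_def wedge_axis)

lemma dx_wedge_swap: "wedge (dx a) (wedge (dx b) \<alpha>) = - wedge (dx b) (wedge (dx a) \<alpha>)"
proof -
  have "wedge (dx a) (dx b) = - wedge (dx b) (dx a)"
    using shuffle_sign_singletons[of a b]
    by (cases "a = b") (auto simp: dx_def wedge_axis insert_commute)
  then show ?thesis
    by (simp flip: wedge_assoc add: wedge_left.neg)
qed

text \<open>The interior product is an antiderivation, checked on basis elements. For
  \<open>a \<noteq> b\<close> both sides vanish unless \<open>b\<close> lies in \<open>S\<close> and
  \<open>a\<close> does not.\<close>

lemma interior_dx_wedge:
  "interior_prod b (wedge (dx a) \<alpha>) = (if a = b then \<alpha> else 0) - wedge (dx a) (interior_prod b \<alpha>)"
proof (rule clinear_eqI[where x = \<alpha>])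
  fix S :: "('a + 'a) set"
  show "interior_prod b (wedge (dx a) (axis S 1)) =
      (if a = b then axis S 1 else 0) - wedge (dx a) (interior_prod b (axis S 1))"
  proof (cases "a = b")
    case True
    then show ?thesis
      by (cases "a \<in> S")
         (simp_all add: dx_wedge_axis interior_axis interior.scale wedge_right.scale insert_absorb
            interior.zero wedge_right.zero)
  next
    case False
    show ?thesis
    proof (cases "b \<in> S \<and> a \<notin> S")
      case True
      obtain R where R: "S = insert b R" "b \<notin> R"
        using True by (meson mk_disjoint_insert)
      then have "insert a (insert b R) - {b} = insert a R"
        using False by auto
      \<comment> \<open>The factors \<open>shuffle_sign {a} {b}\<close> and
        \<open>shuffle_sign {b} {a}\<close> multiply to \<open>-1\<close>; this is the minus sign of
        the antiderivation rule.\<close>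
      moreover have "shuffle_sign {a} {b} * (shuffle_sign {a} R * (shuffle_sign {b} {a} *
          shuffle_sign {b} R)) = - (shuffle_sign {a} R * shuffle_sign {b} R)"
        using shuffle_sign_singletons[OF False] by (simp add: mult_ac)
      ultimately show ?thesis
        using R True False shuffle_sign_insert[of b R a] shuffle_sign_insert[of a R b]
        by (simp add: dx_wedge_axis interior_axis interior.scale wedge_right.scale mult_ac)
    next
      case nin: False
      then show ?thesis
        using False
        by (auto simp: dx_wedge_axis interior_axis interior.scale wedge_right.scale
            interior.zero wedge_right.zero)
    qed
  qed
qed (auto intro!: clinearI simp: interior.add interior.scale wedge_right.add wedge_right.scale
      vec_eq_iff algebra_simps)

text \<open>Removing \<open>a\<close> and \<open>b\<close> in either order leaves the same set, and
  the signs differ by the exchange of \<open>a\<close> with \<open>b\<close>.\<close>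

lemma interior_swap: "interior_prod a (interior_prod b \<alpha>) = - interior_prod b (interior_prod a \<alpha>)"
proof (rule clinear_eqI[where x = \<alpha>])
  fix S :: "('a + 'a) set"
  show "interior_prod a (interior_prod b (axis S 1)) = - interior_prod b (interior_prod a (axis S 1))"
  proof (cases "a \<in> S \<and> b \<in> S \<and> a \<noteq> b")
    case True
    obtain R where R: "S = insert a (insert b R)" "a \<notin> R" "b \<notin> R"
      using True that[of "S - {a, b}"] by auto
    have "S - {a} = insert b R" "S - {b} = insert a R" "S - {a} - {b} = R" "S - {b} - {a} = R"
      using R True by auto
    then show ?thesis
      using R True shuffle_sign_singletons[of a b] shuffle_sign_insert[of b R a]
        shuffle_sign_insert[of a R b]
      by (simp add: interior_axis interior.scale interior.neg mult_ac)
  qed (auto simp: interior_axis interior.scale interior.zero)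
qed (auto intro!: clinearI simp: interior.add interior.scale vec_eq_iff algebra_simps)

section \<open>Contractions and their exponentials\<close>

lemma dx_nth: "dx a $ S = (if S = {a} then 1 else 0)"
  by (simp add: dx_def axis_def)

lemma sum_dx_nth: "(\<Sum>a\<in>UNIV. c a *s dx a) $ {b} = c b"
proof -
  have "(\<Sum>a\<in>UNIV. c a *s dx a) $ {b} = (\<Sum>a\<in>UNIV. if b = a then c a else 0)"
    by (subst sum_component, rule sum.cong) (auto simp: dx_nth)
  then show ?thesis
    by (simp add: sum.delta')
qed

section \<open>One-forms and the parity involution\<close>

definition one_form :: "'n::{finite,linorder} ext \<Rightarrow> bool" where
  "one_form u \<longleftrightarrow> (\<forall>S. u $ S \<noteq> 0 \<longrightarrow> card S = 1)"

lemma one_form_expand: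
  assumes "one_form u"
  shows "u = (\<Sum>a\<in>UNIV. u $ {a} *s dx a)"
proof (rule vec_eq_iff[THEN iffD2, rule_format])
  fix S :: "('a + 'a) set"
  show "u $ S = (\<Sum>a\<in>UNIV. u $ {a} *s dx a) $ S"
  proof (cases "card S = 1")
    case True
    then obtain b where "S = {b}"
      by (auto simp: card_1_singleton_iff)
    then show ?thesis
      by (simp only: sum_dx_nth)
  next
    case False
    then have "dx a $ S = 0" for a
      by (auto simp: dx_nth)
    then show ?thesis
      using assms False by (auto simp: one_form_def)
  qed
qed

lemma one_form_zero [simp]: "one_form 0"
  by (simp add: one_form_def)

lemma one_form_add: "one_form u \<Longrightarrow> one_form v \<Longrightarrow> one_form (u + v)"
  unfolding one_form_def vector_add_component by (metis add_0)

lemma one_form_dx [simp]: "one_form (dx a)"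
  by (simp add: one_form_def dx_nth)

text \<open>The counterpart of \<open>clinear_eqI\<close> for identities that hold in degree
  one.\<close>

lemma one_form_induct:
  assumes "one_form u" and "clinear f" "clinear g" and "\<And>a. f (dx a) = g (dx a)"
  shows "f u = g u"
  by (subst (1 2) one_form_expand[OF assms(1)])
     (simp add: vec.linear_sum[OF assms(2)] vec.linear_sum[OF assms(3)]
        vec.linear_scale[OF assms(2)] vec.linear_scale[OF assms(3)] assms(4))

text \<open>The grading involution. It moves a one-form past a form of mixed degree, where no single
  sign would do.\<close>

definition parity :: "'n::{finite,linorder} ext \<Rightarrow> 'n ext" where
  "parity \<alpha> = (\<chi> S. (- 1) ^ card S * \<alpha> $ S)"

lemma clinear_parity: "clinear parity"
  by (rule clinearI) (simp_all add: parity_def vec_eq_iff algebra_simps)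

interpretation parity: Vector_Spaces.linear "(*s)" "(*s)" parity
  by (rule clinear_parity)

lemma parity_axis: "parity (axis S 1) = (- 1) ^ card S *s axis S 1"
  by (simp add: parity_def vec_eq_iff axis_def)

lemma one_form_wedge_parity:
  assumes "one_form u"
  shows "wedge u \<alpha> = wedge (parity \<alpha>) u"
proof (rule one_form_induct[where u = u])
  fix a
  show "wedge (dx a) \<alpha> = wedge (parity \<alpha>) (dx a)"
  proof (rule clinear_eqI[where x = \<alpha>])
    fix S :: "('a + 'a) set"
    show "wedge (dx a) (axis S 1) = wedge (parity (axis S 1)) (dx a)"
      using shuffle_sign_swap[of a S]
      by (auto simp: parity_axis wedge_left.scale dx_def wedge_axis)
  qed (auto intro!: clinearI simp: parity.add parity.scale wedge_left.add wedge_left.scale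
       wedge_right.add wedge_right.scale)
qed (use assms in \<open>simp_all add: clinear_wedge_left clinear_wedge_right\<close>)

lemma parity_wedge:
  assumes "one_form u"
  shows "parity (wedge u \<alpha>) = - wedge u (parity \<alpha>)"
proof (rule one_form_induct[where u = u])
  fix a
  show "parity (wedge (dx a) \<alpha>) = - wedge (dx a) (parity \<alpha>)"
  proof (rule clinear_eqI[where x = \<alpha>])
    fix S :: "('a + 'a) set"
    show "parity (wedge (dx a) (axis S 1)) = - wedge (dx a) (parity (axis S 1))"
      by (auto simp: parity_axis wedge_right.scale dx_wedge_axis parity.scale parity.zero)
  qed (auto intro!: clinearI simp: parity.add parity.scale wedge_right.add wedge_right.scale
       vec_eq_iff algebra_simps)
qed (use assms in \<open>auto intro!: clinearI simp: parity.add parity.scale wedge_left.add wedge_left.scale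
       vec_eq_iff algebra_simps\<close>)

lemma parity_interior: "parity (interior_prod b \<alpha>) = - interior_prod b (parity \<alpha>)"
proof (rule clinear_eqI[where x = \<alpha>])
  fix S :: "('a + 'a) set"
  show "parity (interior_prod b (axis S 1)) = - interior_prod b (parity (axis S 1))"
  proof (cases "b \<in> S")
    case True
    then obtain R where "S = insert b R" "b \<notin> R"
      by (meson mk_disjoint_insert)
    then show ?thesis
      by (simp add: parity_axis interior_axis interior.scale interior.neg parity.scale mult_ac)
  qed (simp add: parity_axis interior_axis interior.scale parity.zero)
qed (auto intro!: clinearI simp: parity.add parity.scale interior.add interior.scale
       vec_eq_iff algebra_simps)

lemma one_form_wedge_swap:
  assumes "one_form u" "one_form v"
  shows "wedge u (wedge v \<alpha>) = - wedge v (wedge u \<alpha>)"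
proof (rule one_form_induct[where u = u])
  fix a
  show "wedge (dx a) (wedge v \<alpha>) = - wedge v (wedge (dx a) \<alpha>)"
    by (rule one_form_induct[where u = v])
       (use assms in \<open>auto intro!: clinearI dx_wedge_swap simp: wedge_left.add wedge_left.scale
         wedge_right.add wedge_right.scale\<close>)
qed (use assms in \<open>auto intro!: clinearI simp: wedge_left.add wedge_left.scale
         wedge_right.add wedge_right.scale\<close>)

section \<open>Contraction as a derivation of degree zero\<close>

lemma clinear_contract: "clinear (contract A)"
  by (rule clinearI)
     (simp_all add: contract_def interior.add interior.scale wedge_right.add wedge_right.scale
        sum.distrib vec.scale_sum_right)

interpretation contract: Vector_Spaces.linear "(*s)" "(*s)" "contract A"
  for A :: "'n::{finite,linorder} vform"
  by (rule clinear_contract)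

lemma contract_one: "contract A ext_one = 0"
  by (simp add: contract_def ext_one_def interior_axis wedge_right.zero)

abbreviation one_form_valued :: "'n::{finite,linorder} vform \<Rightarrow> bool" where
  "one_form_valued A \<equiv> (\<forall>b. one_form (A $ b))"

text \<open>The interior product yields a minus sign when it passes \<open>dx a\<close>, and moving
  the one-form \<open>A $ b\<close> past \<open>dx a\<close> yields another. They cancel, so the
  Leibniz rule has no sign.\<close>

lemma contract_dx_wedge:
  assumes "one_form_valued A"
  shows "contract A (wedge (dx a) \<alpha>) = wedge (A $ a) \<alpha> + wedge (dx a) (contract A \<alpha>)"
proof -
  have "wedge (A $ b) (interior_prod b (wedge (dx a) \<alpha>)) =
      (if b = a then wedge (A $ a) \<alpha> else 0) + wedge (dx a) (wedge (A $ b) (interior_prod b \<alpha>))" for b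
    using one_form_wedge_swap[of "A $ b" "dx a" "interior_prod b \<alpha>"] assms
    by (auto simp: interior_dx_wedge wedge_right.diff wedge_right.zero wedge_right.neg)
  then show ?thesis
    by (simp add: contract_def sum.distrib wedge_right.sum)
qed

lemma contract_dx:
  assumes "one_form_valued A"
  shows "contract A (dx a) = A $ a"
  using contract_dx_wedge[OF assms, of a ext_one] by (simp add: contract_one wedge_right.zero)

lemma contract_wedge:
  assumes "one_form_valued A" "one_form u"
  shows "contract A (wedge u \<alpha>) = wedge (contract A u) \<alpha> + wedge u (contract A \<alpha>)"
  by (rule one_form_induct[where u = u])
     (use assms in \<open>auto intro!: clinearI simp: contract_dx_wedge contract_dx
        wedge_left.add wedge_left.scale contract.add contract.scale vec.scale_right_distrib\<close>)

lemma parity_contract: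
  assumes "one_form_valued A"
  shows "parity (contract A \<alpha>) = contract A (parity \<alpha>)"
  using assms by (simp add: contract_def parity.sum parity_wedge parity_interior wedge_right.neg)

text \<open>As each contraction kills the coefficients of the other, both act only through interior
  products. Exchanging the two one-forms and exchanging the two interior products each change the
  sign once.\<close>

lemma contract_commute:
  assumes "one_form_valued A" "one_form_valued B"
    and "\<And>b. contract A (B $ b) = 0" "\<And>b. contract B (A $ b) = 0"
  shows "contract A (contract B \<alpha>) = contract B (contract A \<alpha>)"
proof -
  have expand: "contract A (contract B \<alpha>) =
      (\<Sum>b\<in>UNIV. \<Sum>c\<in>UNIV. wedge (B $ b) (wedge (A $ c) (interior_prod c (interior_prod b \<alpha>))))"
    if "one_form_valued A" "one_form_valued B" "\<And>b. contract A (B $ b) = 0"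
    for A B :: "'a vform"
    using that(1,2)
    by (simp add: contract_def[of B] contract.sum contract_wedge that(3) wedge_left.zero)
       (simp add: contract_def wedge_right.sum)
  have "contract A (contract B \<alpha>) =
      (\<Sum>c\<in>UNIV. \<Sum>b\<in>UNIV. wedge (B $ b) (wedge (A $ c) (interior_prod c (interior_prod b \<alpha>))))"
    by (subst expand) (use assms in \<open>auto intro: sum.swap\<close>)
  also have "\<dots> = (\<Sum>c\<in>UNIV. \<Sum>b\<in>UNIV. wedge (A $ c) (wedge (B $ b) (interior_prod b (interior_prod c \<alpha>))))"
  proof (intro sum.cong refl)
    fix b c
    have "wedge (B $ b) (wedge (A $ c) (interior_prod c (interior_prod b \<alpha>))) =
        - wedge (A $ c) (wedge (B $ b) (interior_prod c (interior_prod b \<alpha>)))"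
      using assms(1,2) by (intro one_form_wedge_swap) auto
    then show "wedge (B $ b) (wedge (A $ c) (interior_prod c (interior_prod b \<alpha>))) =
        wedge (A $ c) (wedge (B $ b) (interior_prod b (interior_prod c \<alpha>)))"
      by (simp add: interior_swap[of c b] wedge_right.neg)
  qed
  also have "\<dots> = contract B (contract A \<alpha>)"
    by (subst expand) (use assms in auto)
  finally show ?thesis .
qed

section \<open>Bidegree\<close>

lemma card_sum_set: "card S = card {i. Inl i \<in> S} + card {i. Inr i \<in> S}"
  for S :: "('n::finite + 'n) set"
proof -
  have "S = Inl ` {i. Inl i \<in> S} \<union> Inr ` {i. Inr i \<in> S}"
  proof (intro set_eqI)
    show "x \<in> S \<longleftrightarrow> x \<in> Inl ` {i. Inl i \<in> S} \<union> Inr ` {i. Inr i \<in> S}" for x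
      by (cases x) auto
  qed
  then have "card S = card (Inl ` {i. Inl i \<in> S} \<union> Inr ` {i. Inr i \<in> S} :: ('n + 'n) set)"
    by simp
  also have "\<dots> = card {i. Inl i \<in> S} + card {i. Inr i \<in> S}"
    by (subst card_Un_disjoint) (auto simp: card_image)
  finally show ?thesis .
qed

lemma of_type_axis: "of_type (card {i. Inl i \<in> S}) (card {i. Inr i \<in> S}) (axis S 1)"
  by (auto simp: of_type_def axis_def)

lemma of_type_zero [simp]: "of_type p q 0"
  by (simp add: of_type_def)

lemma of_type_add: "of_type p q \<alpha> \<Longrightarrow> of_type p q \<beta> \<Longrightarrow> of_type p q (\<alpha> + \<beta>)"
  unfolding of_type_def vector_add_component by (metis add_0)

lemma of_type_diff: "of_type p q \<alpha> \<Longrightarrow> of_type p q \<beta> \<Longrightarrow> of_type p q (\<alpha> - \<beta>)"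
  unfolding of_type_def vector_minus_component by (metis diff_0_right)

lemma of_type_scale: "of_type p q \<alpha> \<Longrightarrow> of_type p q (c *s \<alpha>)"
  by (simp add: of_type_def)

lemma of_type_sum: "(\<And>i. i \<in> I \<Longrightarrow> of_type p q (f i)) \<Longrightarrow> of_type p q (sum f I)"
  by (induction I rule: infinite_finite_induct) (auto intro: of_type_add)

lemma of_type_dx [simp]: "of_type 1 0 (dx (Inl i))" "of_type 0 1 (dx (Inr i))"
  by (auto simp: of_type_def dx_nth)

lemma of_type_one_form: "of_type p q u \<Longrightarrow> p + q = 1 \<Longrightarrow> one_form u"
  by (auto simp: of_type_def one_form_def card_sum_set)

text \<open>A nonzero coefficient at \<open>S\<close> comes from a splitting of \<open>S\<close>
  into index sets of both factors, and the counts of \<open>Inl\<close> and \<open>Inr\<close>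
  indices add over the splitting.\<close>

lemma of_type_wedge:
  assumes "of_type p q \<alpha>" "of_type p' q' \<beta>"
  shows "of_type (p + p') (q + q') (wedge \<alpha> \<beta>)"
  unfolding of_type_def
proof (intro allI impI)
  fix S :: "('a + 'a) set"
  assume "wedge \<alpha> \<beta> $ S \<noteq> 0"
  then have "\<exists>T\<in>Pow S. shuffle_sign T (S - T) * \<alpha> $ T * \<beta> $ (S - T) \<noteq> 0"
    unfolding wedge_def vec_lambda_beta by (meson sum.neutral)
  then obtain T where T: "T \<subseteq> S" "\<alpha> $ T \<noteq> 0" "\<beta> $ (S - T) \<noteq> 0"
    by auto
  have split: "card {i. f i \<in> S} = card {i. f i \<in> T} + card {i. f i \<in> S - T}"
    for f :: "'a \<Rightarrow> 'a + 'a"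
  proof -
    have "{i. f i \<in> S} = {i. f i \<in> T} \<union> {i. f i \<in> S - T}"
      using T(1) by auto
    moreover have "{i. f i \<in> T} \<inter> {i. f i \<in> S - T} = {}"
      by auto
    ultimately show ?thesis
      by (simp add: card_Un_disjoint)
  qed
  show "card {i. Inl i \<in> S} = p + p' \<and> card {i. Inr i \<in> S} = q + q'"
    using T assms unfolding of_type_def split[of Inl] split[of Inr] by auto
qed

text \<open>Since \<open>p - 1\<close> is truncated at \<open>p = 0\<close>, vanishing in that case
  is recorded as a second claim. Both follow from the exact count with \<open>+ 1\<close> on the
  left.\<close>

lemma of_type_interior_Inl:
  assumes "of_type p q \<alpha>"
  shows "of_type (p - 1) q (interior_prod (Inl i) \<alpha>)"
    and "p = 0 \<Longrightarrow> interior_prod (Inl i) \<alpha> = 0"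
proof -
  have "card {j. Inl j \<in> S} + 1 = p \<and> card {j. Inr j \<in> S} = q"
    if "interior_prod (Inl i) \<alpha> $ S \<noteq> 0" for S
  proof -
    have "Inl i \<notin> S" "\<alpha> $ insert (Inl i) S \<noteq> 0"
      using that by (auto simp: interior_prod_def split: if_splits)
    moreover have "{j. Inl j \<in> insert (Inl i) S} = insert i {j. Inl j \<in> S}"
      by auto
    ultimately show ?thesis
      using assms by (auto simp: of_type_def)
  qed
  then show "of_type (p - 1) q (interior_prod (Inl i) \<alpha>)"
    and "p = 0 \<Longrightarrow> interior_prod (Inl i) \<alpha> = 0"
    by (fastforce simp: of_type_def vec_eq_iff)+
qed

lemma of_type_interior_Inr:
  assumes "of_type p q \<alpha>"
  shows "of_type p (q - 1) (interior_prod (Inr i) \<alpha>)"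
    and "q = 0 \<Longrightarrow> interior_prod (Inr i) \<alpha> = 0"
proof -
  have "card {j. Inl j \<in> S} = p \<and> card {j. Inr j \<in> S} + 1 = q"
    if "interior_prod (Inr i) \<alpha> $ S \<noteq> 0" for S
  proof -
    have "Inr i \<notin> S" "\<alpha> $ insert (Inr i) S \<noteq> 0"
      using that by (auto simp: interior_prod_def split: if_splits)
    moreover have "{j. Inr j \<in> insert (Inr i) S} = insert i {j. Inr j \<in> S}"
      by auto
    ultimately show ?thesis
      using assms by (auto simp: of_type_def)
  qed
  then show "of_type p (q - 1) (interior_prod (Inr i) \<alpha>)"
    and "q = 0 \<Longrightarrow> interior_prod (Inr i) \<alpha> = 0"
    by (fastforce simp: of_type_def vec_eq_iff)+
qed

lemma sum_UNIV_Plus: "(\<Sum>a\<in>UNIV. f a) = (\<Sum>i\<in>UNIV. f (Inl i)) + (\<Sum>i\<in>UNIV. f (Inr i))"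
  for f :: "'n::finite + 'n \<Rightarrow> 'b::comm_monoid_add"
  by (simp add: UNIV_Plus_UNIV[symmetric] sum.Plus del: UNIV_Plus_UNIV)

lemma of_type_01_expand:
  assumes "of_type 0 1 u"
  shows "u = (\<Sum>k\<in>UNIV. u $ {Inr k} *s dx (Inr k))"
proof -
  have "u $ {Inl k} = 0" for k
    using assms by (auto simp: of_type_def dest!: spec[of _ "{Inl k}"])
  then show ?thesis
    using one_form_expand[OF of_type_one_form[OF assms]] by (simp add: sum_UNIV_Plus)
qed

text \<open>The type condition of \<open>beltrami_forms\<close> at a single point;
  \<open>cobeltrami\<close> below is its complex conjugate.\<close>

definition beltrami :: "'n::{finite,linorder} vform \<Rightarrow> bool" where
  "beltrami A \<longleftrightarrow> (\<forall>i. of_type 0 1 (A $ Inl i) \<and> A $ Inr i = 0)"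

definition cobeltrami :: "'n::{finite,linorder} vform \<Rightarrow> bool" where
  "cobeltrami A \<longleftrightarrow> (\<forall>i. of_type 1 0 (A $ Inr i) \<and> A $ Inl i = 0)"

lemma all_sum: "(\<forall>b. P b) \<longleftrightarrow> (\<forall>i. P (Inl i)) \<and> (\<forall>i. P (Inr i))"
  by (metis sum.exhaust)

lemma beltrami_one_form: "beltrami A \<Longrightarrow> one_form_valued A"
  unfolding beltrami_def all_sum by (auto intro: of_type_one_form)

lemma cobeltrami_one_form: "cobeltrami A \<Longrightarrow> one_form_valued A"
  unfolding cobeltrami_def all_sum by (auto intro: of_type_one_form)

lemma contract_beltrami:
  "beltrami A \<Longrightarrow> contract A \<alpha> = (\<Sum>i\<in>UNIV. wedge (A $ Inl i) (interior_prod (Inl i) \<alpha>))"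
  by (simp add: contract_def sum_UNIV_Plus beltrami_def wedge_left.zero)

lemma contract_cobeltrami:
  "cobeltrami A \<Longrightarrow> contract A \<alpha> = (\<Sum>i\<in>UNIV. wedge (A $ Inr i) (interior_prod (Inr i) \<alpha>))"
  by (simp add: contract_def sum_UNIV_Plus cobeltrami_def wedge_left.zero)

text \<open>Contraction replaces one factor \<open>dx (Inl i)\<close> by a one-form of type (0,1);
  without such a factor there is nothing to replace.\<close>

lemma of_type_contract_beltrami:
  assumes "beltrami A" "of_type p q \<alpha>"
  shows "p > 0 \<Longrightarrow> of_type (p - 1) (Suc q) (contract A \<alpha>)"
    and "p = 0 \<Longrightarrow> contract A \<alpha> = 0"
proof -
  have "of_type (0 + (p - 1)) (1 + q) (wedge (A $ Inl i) (interior_prod (Inl i) \<alpha>))" for i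
    using assms by (intro of_type_wedge of_type_interior_Inl) (auto simp: beltrami_def)
  then show "p > 0 \<Longrightarrow> of_type (p - 1) (Suc q) (contract A \<alpha>)"
    using assms(1) by (auto simp: contract_beltrami intro!: of_type_sum)
  show "p = 0 \<Longrightarrow> contract A \<alpha> = 0"
    using of_type_interior_Inl(2)[OF assms(2)] assms(1) by (simp add: contract_beltrami wedge_right.zero)
qed

lemma contract_cobeltrami_zero:
  assumes "cobeltrami A" "of_type p 0 \<alpha>"
  shows "contract A \<alpha> = 0"
  using of_type_interior_Inr(2)[OF assms(2)] assms(1)
  by (simp add: contract_cobeltrami wedge_right.zero)

text \<open>The coefficients have type (0,1), whereas both contractions act only on the
  differentials \<open>dx (Inl i)\<close>, so each kills the coefficients of the other.\<close>

lemma beltrami_commute: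
  assumes "beltrami A" "beltrami B"
  shows "contract A (contract B \<alpha>) = contract B (contract A \<alpha>)"
proof (rule contract_commute)
  have "contract A (B $ b) = 0" if "beltrami A" "beltrami B" for A B :: "'a vform" and b
    using that of_type_contract_beltrami(2)[of A 0 1 "B $ b"]
    by (cases b) (auto simp: beltrami_def contract.zero)
  then show "contract A (B $ b) = 0" "contract B (A $ b) = 0" for b
    using assms by auto
qed (use assms beltrami_one_form in auto)

section \<open>Nilpotency and the exponential series\<close>

lemma clinear_funpow: "clinear f \<Longrightarrow> clinear (f ^^ k)"
  for f :: "complex ^ 'a \<Rightarrow> complex ^ 'a"
  by (induction k)
     (auto intro!: clinearI simp: vec.linear_add vec.linear_scale)

lemma clinear_zero: "clinear (\<lambda>x. 0)"
  by (rule clinearI) auto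

text \<open>Every contraction lowers the holomorphic degree by one, and this degree is at most
  \<open>CARD('n)\<close>.\<close>

lemma contract_funpow_eq_0:
  fixes \<alpha> :: "'n::{finite,linorder} ext"
  assumes "beltrami A" "k > CARD('n)"
  shows "(contract A ^^ k) \<alpha> = 0"
proof -
  \<comment> \<open>The type changes along the induction, so the bound is stated for one bidegree at
    a time; a general form is a combination of the \<open>axis S 1\<close>, each of which has a
    type.\<close>
  have nil: "(contract A ^^ k) \<alpha> = 0" if "of_type p q \<alpha>" "p < k" for p q k and \<alpha> :: "'n ext"
    using that
  proof (induction k arbitrary: p q \<alpha>)
    case (Suc k)
    show ?case
    proof (cases "p = 0")
      case True
      then show ?thesis
        using of_type_contract_beltrami(2)[OF assms(1) Suc.prems(1)]
        by (simp add: funpow_Suc_right vec.linear_0[OF clinear_funpow[OF clinear_contract]]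
             del: funpow.simps)
    next
      case False
      then show ?thesis
        using of_type_contract_beltrami(1)[OF assms(1) Suc.prems(1)] Suc.prems(2)
          Suc.IH[of "p - 1" "Suc q" "contract A \<alpha>"]
        by (simp add: funpow_Suc_right del: funpow.simps)
    qed
  qed simp
  show ?thesis
  proof (rule clinear_eqI[where x = \<alpha> and g = "\<lambda>_. 0"])
    fix S :: "('n + 'n) set"
    have "card {i. Inl i \<in> S} < k"
      using assms(2) by (meson card_mono finite le_less_trans top_greatest)
    then show "(contract A ^^ k) (axis S 1) = 0"
      by (rule nil[OF of_type_axis])
  qed (simp_all add: clinear_zero clinear_funpow clinear_contract)
qed

lemma scaleR_eq_smult: "r *\<^sub>R x = complex_of_real r *s x" for x :: "complex ^ 'a"
proof (rule vec_eq_iff[THEN iffD2, rule_format])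
  show "(r *\<^sub>R x) $ i = (complex_of_real r *s x) $ i" for i
    by (simp add: scaleR_conv_of_real[of r "x $ i"])
qed

lemma exp_contract_finite:
  assumes "\<And>k. k \<ge> N \<Longrightarrow> (contract A ^^ k) \<alpha> = 0"
  shows "exp_contract A \<alpha> = (\<Sum>k<N. (1 / fact k) *s (contract A ^^ k) \<alpha>)"
proof -
  have "exp_contract A \<alpha> = (\<Sum>k<N. (1 / fact k) *\<^sub>R (contract A ^^ k) \<alpha>)"
    unfolding exp_contract_def using assms by (intro suminf_finite) auto
  then show ?thesis
    by (simp add: scaleR_eq_smult)
qed

text \<open>Every truncation beyond the dimension gives the same value; the free length
  \<open>N\<close> later allows sums to be shifted by one index.\<close>

lemma exp_contract_beltrami:
  fixes \<alpha> :: "'n::{finite,linorder} ext"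
  assumes "beltrami A" "N > CARD('n)"
  shows "exp_contract A \<alpha> = (\<Sum>k<N. (1 / fact k) *s (contract A ^^ k) \<alpha>)"
  by (rule exp_contract_finite, rule contract_funpow_eq_0) (use assms in auto)

lemma clinear_exp_contract:
  assumes "beltrami (A :: 'n::{finite,linorder} vform)"
  shows "clinear (exp_contract A)"
proof (rule clinearI)
  note lin = clinear_funpow[OF clinear_contract]
  show "exp_contract A (x + y) = exp_contract A x + exp_contract A y" for x y
    by (simp add: exp_contract_beltrami[OF assms lessI] vec.linear_add[OF lin]
        vec.scale_right_distrib sum.distrib)
  show "exp_contract A (c *s x) = c *s exp_contract A x" for c x
    by (simp add: exp_contract_beltrami[OF assms lessI] vec.linear_scale[OF lin]
        vec.scale_sum_right mult.commute)
qed

text \<open>The exponential of a nilpotent derivation is multiplicative. Since contraction sends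
  \<open>u\<close> to \<open>v\<close> and \<open>v\<close> to zero, the exponential of
  \<open>u\<close> alone is \<open>u + v\<close>.\<close>

lemma exp_contract_wedge:
  assumes "beltrami A" "one_form u" and v: "contract A u = v" "contract A v = 0" "one_form v"
  shows "exp_contract A (wedge u \<alpha>) = wedge (u + v) (exp_contract A \<alpha>)"
proof -
  let ?c = "\<lambda>k. (contract A ^^ k) \<alpha>" and ?N = "Suc CARD('a)"
  note A1 = beltrami_one_form[OF assms(1)]
  \<comment> \<open>The Leibniz formula for powers; only two of its terms survive because
    contracting \<open>u\<close> twice gives zero.\<close>
  have pow: "(contract A ^^ Suc k) (wedge u \<alpha>) =
      wedge u (?c (Suc k)) + of_nat (Suc k) *s wedge v (?c k)" for k
  proof (induction k)
    case 0
    then show ?case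
      using assms A1 by (simp add: contract_wedge)
  next
    case (Suc k)
    have "(contract A ^^ Suc (Suc k)) (wedge u \<alpha>) =
        contract A (wedge u (?c (Suc k)) + of_nat (Suc k) *s wedge v (?c k))"
      using Suc by simp
    also have "\<dots> = wedge v (?c (Suc k)) + wedge u (?c (Suc (Suc k))) +
        of_nat (Suc k) *s wedge v (?c (Suc k))"
      using assms A1 by (simp add: contract.add contract.scale contract_wedge wedge_left.zero)
    also have "\<dots> = wedge u (?c (Suc (Suc k))) + (1 + of_nat (Suc k)) *s wedge v (?c (Suc k))"
      by (simp only: vec.scale_left_distrib vec.scale_one ac_simps)
    finally show ?case
      by simp
  qed
  \<comment> \<open>The extra term makes up for splitting off \<open>k = 0\<close>: the shifted sum
    with \<open>?N\<close> terms still exhausts the exponential.\<close>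
  have "exp_contract A (wedge u \<alpha>) = (\<Sum>k<Suc ?N. (1 / fact k) *s (contract A ^^ k) (wedge u \<alpha>))"
    by (rule exp_contract_beltrami[OF assms(1)]) simp
  also have "\<dots> = wedge u \<alpha> + (\<Sum>k<?N. (1 / fact (Suc k)) *s wedge u (?c (Suc k)) +
      (1 / fact (Suc k)) *s (of_nat (Suc k) *s wedge v (?c k)))"
    by (subst sum.lessThan_Suc_shift) (simp only: pow vec.scale_right_distrib, simp)
  also have "\<dots> = (wedge u \<alpha> + (\<Sum>k<?N. (1 / fact (Suc k)) *s wedge u (?c (Suc k)))) +
      (\<Sum>k<?N. (1 / fact (Suc k)) *s (of_nat (Suc k) *s wedge v (?c k)))"
    by (simp only: sum.distrib add.assoc)
  also have "wedge u \<alpha> + (\<Sum>k<?N. (1 / fact (Suc k)) *s wedge u (?c (Suc k))) =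
      (\<Sum>k<Suc ?N. (1 / fact k) *s wedge u (?c k))"
    by (subst sum.lessThan_Suc_shift) simp
  also have "\<dots> = wedge u (exp_contract A \<alpha>)"
    by (subst exp_contract_beltrami[OF assms(1), of "Suc ?N"])
       (simp, simp only: wedge_right.sum wedge_right.scale)
  also have "(\<Sum>k<?N. (1 / fact (Suc k)) *s (of_nat (Suc k) *s wedge v (?c k))) =
      (\<Sum>k<?N. (1 / fact k) *s wedge v (?c k))"
  proof (intro sum.cong refl)
    fix k
    have "1 / fact (Suc k) * of_nat (Suc k) = (1 / fact k :: complex)"
      by (simp add: field_simps del: of_nat_Suc)
    then show "(1 / fact (Suc k)) *s (of_nat (Suc k) *s wedge v (?c k)) = (1 / fact k) *s wedge v (?c k)"
      by (simp only: vec.scale_scale)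
  qed
  also have "\<dots> = wedge v (exp_contract A \<alpha>)"
    by (subst exp_contract_beltrami[OF assms(1), of ?N])
       (simp, simp only: wedge_right.sum wedge_right.scale)
  finally show ?thesis
    by (simp add: wedge_left.add)
qed

section \<open>Differentiation of forms\<close>

text \<open>The Wirtinger operator as a function of the total derivative \<open>D\<close> of a
  vector-valued map, so that product rules reduce to those for
  \<open>has_derivative\<close>.\<close>

definition wirtinger_part :: "'n::finite + 'n \<Rightarrow> ('n cvec \<Rightarrow> complex ^ 'a) \<Rightarrow> complex ^ 'a" where
  "wirtinger_part a D = (case a of
     Inl i \<Rightarrow> (1 / 2) *s (D (axis i 1) - \<i> *s D (axis i \<i>))
   | Inr i \<Rightarrow> (1 / 2) *s (D (axis i 1) + \<i> *s D (axis i \<i>)))"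

lemma partial_form_eq:
  assumes "(\<alpha> has_derivative D) (at z)"
  shows "partial_form a \<alpha> z = wirtinger_part a D"
proof (rule vec_eq_iff[THEN iffD2, rule_format])
  fix S
  have "((\<lambda>w. \<alpha> w $ S) has_derivative (\<lambda>h. D h $ S)) (at z)"
    by (rule bounded_linear.has_derivative[OF bounded_linear_vec_nth assms])
  then have "frechet_derivative (\<lambda>w. \<alpha> w $ S) (at z) = (\<lambda>h. D h $ S)"
    by (metis frechet_derivative_at)
  then show "partial_form a \<alpha> z $ S = wirtinger_part a D $ S"
    by (simp add: partial_form_def wirtinger_def wirtinger_part_def split: sum.splits)
qed

text \<open>\<open>frechet_derivative\<close> is a choice among all derivatives, and functions that
  agree near \<open>z\<close> have the same derivatives there; this also covers coefficients that
  are not differentiable.\<close>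

lemma partial_form_cong:
  assumes "open U" "z \<in> U" and eq: "\<And>y. y \<in> U \<Longrightarrow> \<alpha> y = \<beta> y"
  shows "partial_form a \<alpha> z = partial_form a \<beta> z"
proof -
  have iff: "((\<lambda>w. \<alpha> w $ S) has_derivative f') (at z) \<longleftrightarrow> ((\<lambda>w. \<beta> w $ S) has_derivative f') (at z)" for S f'
    using has_derivative_transform_within_open[OF _ assms(1,2), of "\<lambda>w. \<alpha> w $ S" f' UNIV "\<lambda>w. \<beta> w $ S"]
      has_derivative_transform_within_open[OF _ assms(1,2), of "\<lambda>w. \<beta> w $ S" f' UNIV "\<lambda>w. \<alpha> w $ S"] eq
    by auto
  have "frechet_derivative (\<lambda>w. \<alpha> w $ S) (at z) = frechet_derivative (\<lambda>w. \<beta> w $ S) (at z)" for S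
    by (simp only: frechet_derivative_def iff)
  then show ?thesis
    by (cases a) (simp_all add: partial_form_def wirtinger_def)
qed

lemma ext_d_cong:
  assumes "open U" "z \<in> U" "\<And>y. y \<in> U \<Longrightarrow> \<alpha> y = \<beta> y"
  shows "ext_d \<alpha> z = ext_d \<beta> z"
  using partial_form_cong[OF assms] by (simp add: ext_d_def)

text \<open>A coefficient outside the type vanishes on a neighbourhood of \<open>z\<close>, hence so
  does its derivative.\<close>

lemma of_type_partial_form:
  assumes "open U" "z \<in> U" and type: "\<And>y. y \<in> U \<Longrightarrow> of_type p q (\<alpha> y)"
  shows "of_type p q (partial_form a \<alpha> z)"
  unfolding of_type_def
proof (intro allI impI)
  fix S
  assume "partial_form a \<alpha> z $ S \<noteq> 0"
  then have ne: "wirtinger a (\<lambda>w. \<alpha> w $ S) z \<noteq> 0"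
    by (simp add: partial_form_def)
  show "card {i. Inl i \<in> S} = p \<and> card {i. Inr i \<in> S} = q"
  proof (rule ccontr)
    assume "\<not> ?thesis"
    then have "\<alpha> y $ S = 0" if "y \<in> U" for y
      using type[OF that] by (auto simp: of_type_def)
    then have "((\<lambda>w. \<alpha> w $ S) has_derivative (\<lambda>_. 0)) (at z)"
      using has_derivative_transform_within_open[OF has_derivative_const assms(1,2)] by metis
    then have "frechet_derivative (\<lambda>w. \<alpha> w $ S) (at z) = (\<lambda>_. 0)"
      by (metis frechet_derivative_at)
    then show False
      using ne by (simp add: wirtinger_def split: sum.splits)
  qed
qed

section \<open>Product rules for coefficientwise derivatives\<close>

lemma clinear_bounded_linear:
  fixes f :: "complex ^ 'a::finite \<Rightarrow> complex ^ 'b::finite"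
  assumes "clinear f"
  shows "bounded_linear f"
  using vec.linear_add[OF assms] vec.linear_scale[OF assms]
  by (auto intro!: linearI simp: scaleR_eq_smult simp flip: linear_conv_bounded_linear)

lemma bounded_bilinear_wedge: "bounded_bilinear wedge"
  by (auto simp: bilinear_def bounded_linear.linear clinear_bounded_linear clinear_wedge_left
      clinear_wedge_right simp flip: bilinear_conv_bounded_bilinear)

lemma differentiable_clinear:
  assumes "clinear f" "\<alpha> differentiable (at z)"
  shows "(\<lambda>y. f (\<alpha> y)) differentiable (at z)"
  using assms(2) bounded_linear.has_derivative[OF clinear_bounded_linear[OF assms(1)]]
  unfolding differentiable_def by blast

text \<open>Complex linearity is what lets \<open>f\<close> pass the factor \<open>\<i>\<close> in
  the Wirtinger combination.\<close>

lemma partial_form_clinear: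
  assumes "clinear f" "\<alpha> differentiable (at z)"
  shows "partial_form a (\<lambda>y. f (\<alpha> y)) z = f (partial_form a \<alpha> z)"
proof -
  obtain D where D: "(\<alpha> has_derivative D) (at z)"
    using assms(2) by (auto simp: differentiable_def)
  show ?thesis
    unfolding partial_form_eq[OF D]
      partial_form_eq[OF bounded_linear.has_derivative[OF clinear_bounded_linear[OF assms(1)] D]]
    by (simp add: wirtinger_part_def vec.linear_add[OF assms(1)] vec.linear_diff[OF assms(1)]
        vec.linear_scale[OF assms(1)] split: sum.splits)
qed

lemma differentiable_wedge:
  assumes "\<alpha> differentiable (at z)" "\<beta> differentiable (at z)"
  shows "(\<lambda>y. wedge (\<alpha> y) (\<beta> y)) differentiable (at z)"
  using assms bounded_bilinear.FDERIV[OF bounded_bilinear_wedge]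
  unfolding differentiable_def by blast

lemma partial_form_wedge:
  assumes "\<alpha> differentiable (at z)" "\<beta> differentiable (at z)"
  shows "partial_form a (\<lambda>y. wedge (\<alpha> y) (\<beta> y)) z =
    wedge (partial_form a \<alpha> z) (\<beta> z) + wedge (\<alpha> z) (partial_form a \<beta> z)"
proof -
  obtain D E where D: "(\<alpha> has_derivative D) (at z)" and E: "(\<beta> has_derivative E) (at z)"
    using assms by (auto simp: differentiable_def)
  show ?thesis
    unfolding partial_form_eq[OF D] partial_form_eq[OF E]
      partial_form_eq[OF bounded_bilinear.FDERIV[OF bounded_bilinear_wedge D E]]
    by (simp add: wirtinger_part_def wedge_left.add wedge_right.add wedge_left.diff wedge_right.diff
        wedge_left.scale wedge_right.scale vec.scale_right_distrib vec.scale_right_diff_distrib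
        split: sum.splits)
qed

lemma partial_form_add:
  assumes "\<alpha> differentiable (at z)" "\<beta> differentiable (at z)"
  shows "partial_form a (\<lambda>y. \<alpha> y + \<beta> y) z = partial_form a \<alpha> z + partial_form a \<beta> z"
proof -
  obtain D E where D: "(\<alpha> has_derivative D) (at z)" and E: "(\<beta> has_derivative E) (at z)"
    using assms by (auto simp: differentiable_def)
  show ?thesis
    unfolding partial_form_eq[OF D] partial_form_eq[OF E]
      partial_form_eq[OF has_derivative_add[OF D E]]
    by (simp add: wirtinger_part_def vec.scale_right_distrib vec.scale_right_diff_distrib
        split: sum.splits)
qed

lemma partial_form_zero: "partial_form a (\<lambda>y. 0) z = 0"
  by (simp add: partial_form_eq[OF has_derivative_const] wirtinger_part_def split: sum.splits)

text \<open>One induction proves both claims, since differentiating a sum uses differentiability of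
  the partial sum.\<close>

lemma differentiable_partial_form_sum:
  assumes "finite I" "\<And>i. i \<in> I \<Longrightarrow> (\<lambda>y. f y i) differentiable (at z)"
  shows "(\<lambda>y. \<Sum>i\<in>I. f y i) differentiable (at z) \<and>
    partial_form a (\<lambda>y. \<Sum>i\<in>I. f y i) z = (\<Sum>i\<in>I. partial_form a (\<lambda>y. f y i) z)"
  using assms
  by (induction I rule: finite_induct) (auto simp: partial_form_add partial_form_zero)

section \<open>Derivatives of contractions and of their exponentials\<close>

definition partial_vform ::
    "'n + 'n \<Rightarrow> ('n cvec \<Rightarrow> 'n vform) \<Rightarrow> 'n cvec \<Rightarrow> 'n::{finite,linorder} vform" where
  "partial_vform a \<Phi> z = (\<chi> b. partial_form a (\<lambda>y. \<Phi> y $ b) z)"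

lemma partial_vform_nth: "partial_vform a \<Phi> z $ b = partial_form a (\<lambda>y. \<Phi> y $ b) z"
  by (simp add: partial_vform_def)

lemma beltrami_partial_vform:
  assumes "open U" "z \<in> U" "\<And>y. y \<in> U \<Longrightarrow> beltrami (\<Phi> y)"
  shows "beltrami (partial_vform a \<Phi> z)"
proof -
  have "partial_form a (\<lambda>y. \<Phi> y $ Inr i) z = partial_form a (\<lambda>y. 0) z" for i
    by (rule partial_form_cong[OF assms(1,2)]) (use assms(3) in \<open>auto simp: beltrami_def\<close>)
  moreover have "of_type 0 1 (partial_form a (\<lambda>y. \<Phi> y $ Inl i) z)" for i
    by (rule of_type_partial_form[OF assms(1,2)]) (use assms(3) in \<open>auto simp: beltrami_def\<close>)
  ultimately show ?thesis
    by (simp add: beltrami_def partial_vform_nth partial_form_zero)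
qed

lemma differentiable_vform_nth:
  assumes "\<Phi> differentiable (at z)"
  shows "(\<lambda>y. \<Phi> y $ b) differentiable (at z)"
  using assms bounded_linear.has_derivative[OF bounded_linear_vec_nth]
  unfolding differentiable_def by blast

lemma differentiable_contract:
  fixes \<Phi> :: "'n::{finite,linorder} cvec \<Rightarrow> 'n vform"
  assumes "\<Phi> differentiable (at z)" "w differentiable (at z)"
  shows "(\<lambda>y. contract (\<Phi> y) (w y)) differentiable (at z)"
  unfolding contract_def
  by (rule differentiable_partial_form_sum[THEN conjunct1])
     (use assms in \<open>auto intro!: differentiable_wedge differentiable_clinear[OF clinear_interior]
        differentiable_vform_nth\<close>)

lemma partial_form_contract:
  assumes "\<Phi> differentiable (at z)" "w differentiable (at z)"
  shows "partial_form a (\<lambda>y. contract (\<Phi> y) (w y)) z =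
    contract (partial_vform a \<Phi> z) (w z) + contract (\<Phi> z) (partial_form a w z)"
proof -
  have "(\<lambda>y. wedge (\<Phi> y $ b) (interior_prod b (w y))) differentiable (at z)" for b
    using assms
    by (intro differentiable_wedge differentiable_clinear[OF clinear_interior] differentiable_vform_nth)
  then have "partial_form a (\<lambda>y. contract (\<Phi> y) (w y)) z =
      (\<Sum>b\<in>UNIV. partial_form a (\<lambda>y. wedge (\<Phi> y $ b) (interior_prod b (w y))) z)"
    unfolding contract_def by (intro differentiable_partial_form_sum[THEN conjunct2]) auto
  moreover have "partial_form a (\<lambda>y. wedge (\<Phi> y $ b) (interior_prod b (w y))) z =
      wedge (partial_form a (\<lambda>y. \<Phi> y $ b) z) (interior_prod b (w z)) +
      wedge (\<Phi> z $ b) (interior_prod b (partial_form a w z))" for b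
    using assms
    by (simp add: partial_form_wedge differentiable_clinear[OF clinear_interior]
        differentiable_vform_nth partial_form_clinear[OF clinear_interior])
  ultimately show ?thesis
    by (simp add: contract_def partial_vform_nth sum.distrib)
qed

lemma differentiable_contract_funpow:
  fixes \<Phi> :: "'n::{finite,linorder} cvec \<Rightarrow> 'n vform"
  assumes "\<Phi> differentiable (at z)" "w differentiable (at z)"
  shows "(\<lambda>y. (contract (\<Phi> y) ^^ k) (w y)) differentiable (at z)"
  by (induction k) (use assms in \<open>auto intro: differentiable_contract\<close>)

text \<open>The power rule: the derivative of \<open>\<Phi>\<close> is again Beltrami, so its
  contraction commutes with that of \<open>\<Phi>\<close> and can be moved innermost.\<close>

lemma partial_form_contract_funpow:
  assumes "open U" "z \<in> U" "\<And>y. y \<in> U \<Longrightarrow> beltrami (\<Phi> y)"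
    and diff: "\<Phi> differentiable (at z)" "w differentiable (at z)"
  shows "partial_form a (\<lambda>y. (contract (\<Phi> y) ^^ Suc k) (w y)) z =
    (contract (\<Phi> z) ^^ Suc k) (partial_form a w z) +
    of_nat (Suc k) *s (contract (\<Phi> z) ^^ k) (contract (partial_vform a \<Phi> z) (w z))"
proof (induction k)
  case 0
  show ?case
    using partial_form_contract[OF diff] by simp
next
  case (Suc k)
  define A where "A = partial_vform a \<Phi> z"
  have bel: "beltrami A" "beltrami (\<Phi> z)"
    using beltrami_partial_vform[OF assms(1-3)] assms(2,3) by (auto simp: A_def)
  have commute: "contract A ((contract (\<Phi> z) ^^ j) \<alpha>) = (contract (\<Phi> z) ^^ j) (contract A \<alpha>)" for j \<alpha>
    by (induction j) (simp_all add: beltrami_commute[OF bel])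
  have "partial_form a (\<lambda>y. (contract (\<Phi> y) ^^ Suc (Suc k)) (w y)) z =
      contract A ((contract (\<Phi> z) ^^ Suc k) (w z)) +
      contract (\<Phi> z) (partial_form a (\<lambda>y. (contract (\<Phi> y) ^^ Suc k) (w y)) z)"
    using partial_form_contract[OF diff(1) differentiable_contract_funpow[OF diff, of "Suc k"], of a]
    by (simp add: A_def)
  also have "\<dots> = (contract (\<Phi> z) ^^ Suc (Suc k)) (partial_form a w z) +
      (of_nat (Suc k) *s (contract (\<Phi> z) ^^ Suc k) (contract A (w z)) +
       (contract (\<Phi> z) ^^ Suc k) (contract A (w z)))"
    unfolding Suc commute contract.add contract.scale by (simp add: A_def)
  also have "of_nat (Suc k) *s (contract (\<Phi> z) ^^ Suc k) (contract A (w z)) +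
       (contract (\<Phi> z) ^^ Suc k) (contract A (w z)) =
      (of_nat (Suc k) + 1) *s (contract (\<Phi> z) ^^ Suc k) (contract A (w z))"
    by (simp only: vec.scale_left_distrib vec.scale_one)
  finally show ?case
    by (simp add: A_def add.commute)
qed

lemma partial_form_exp_contract:
  fixes z :: "'n::{finite,linorder} cvec"
  assumes "open U" "z \<in> U" and bel: "\<And>y. y \<in> U \<Longrightarrow> beltrami (\<Phi> y)"
    and diff: "\<Phi> differentiable (at z)" "w differentiable (at z)"
  shows "partial_form a (\<lambda>y. exp_contract (\<Phi> y) (w y)) z =
    exp_contract (\<Phi> z) (partial_form a w z + contract (partial_vform a \<Phi> z) (w z))"
proof -
  let ?N = "Suc CARD('n)"
  let ?P = "\<lambda>k y. (contract (\<Phi> y) ^^ k) (w y)"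
  let ?c = "\<lambda>k. contract (\<Phi> z) ^^ k"
  let ?v = "contract (partial_vform a \<Phi> z) (w z)"
  have bel_z: "beltrami (\<Phi> z)"
    using bel assms(2) .
  have scale: "clinear (\<lambda>\<alpha>. c *s \<alpha>)" for c :: complex
    by (rule clinearI) (simp_all add: vec.scale_right_distrib mult.commute)
  \<comment> \<open>The series is made finite on all of \<open>U\<close>, not only at
    \<open>z\<close>, before it is differentiated.\<close>
  have "partial_form a (\<lambda>y. exp_contract (\<Phi> y) (w y)) z =
      partial_form a (\<lambda>y. \<Sum>k<Suc ?N. (1 / fact k) *s ?P k y) z"
    by (rule partial_form_cong[OF assms(1,2)]) (intro exp_contract_beltrami bel, simp_all)
  also have "\<dots> = (\<Sum>k<Suc ?N. (1 / fact k) *s partial_form a (?P k) z)"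
    using differentiable_partial_form_sum[of "{..<Suc ?N}" "\<lambda>y k. (1 / fact k) *s ?P k y" z a]
      differentiable_clinear[OF scale differentiable_contract_funpow[OF diff]]
    by (simp only: partial_form_clinear[OF scale differentiable_contract_funpow[OF diff]]) simp
  \<comment> \<open>The power rule is stated for positive exponents, so the term
    \<open>k = 0\<close> is split off first.\<close>
  also have "\<dots> = partial_form a w z +
      (\<Sum>k<?N. (1 / fact (Suc k)) *s ?c (Suc k) (partial_form a w z) +
        (1 / fact (Suc k)) *s (of_nat (Suc k) *s ?c k ?v))"
    by (subst sum.lessThan_Suc_shift)
       (simp only: partial_form_contract_funpow[OF assms] vec.scale_right_distrib, simp)
  also have "\<dots> = (partial_form a w z + (\<Sum>k<?N. (1 / fact (Suc k)) *s ?c (Suc k) (partial_form a w z))) +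
        (\<Sum>k<?N. (1 / fact (Suc k)) *s (of_nat (Suc k) *s ?c k ?v))"
    by (simp only: sum.distrib add.assoc)
  also have "partial_form a w z + (\<Sum>k<?N. (1 / fact (Suc k)) *s ?c (Suc k) (partial_form a w z)) =
      (\<Sum>k<Suc ?N. (1 / fact k) *s ?c k (partial_form a w z))"
    by (subst sum.lessThan_Suc_shift) simp
  also have "\<dots> = exp_contract (\<Phi> z) (partial_form a w z)"
    by (rule exp_contract_beltrami[OF bel_z, symmetric]) simp
  also have "(\<Sum>k<?N. (1 / fact (Suc k)) *s (of_nat (Suc k) *s ?c k ?v)) =
      (\<Sum>k<?N. (1 / fact k) *s ?c k ?v)"
  proof (intro sum.cong refl)
    fix k
    have "1 / fact (Suc k) * of_nat (Suc k) = (1 / fact k :: complex)"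
      by (simp add: field_simps del: of_nat_Suc)
    then show "(1 / fact (Suc k)) *s (of_nat (Suc k) *s ?c k ?v) = (1 / fact k) *s ?c k ?v"
      by (simp only: vec.scale_scale)
  qed
  also have "\<dots> = exp_contract (\<Phi> z) ?v"
    by (rule exp_contract_beltrami[OF bel_z, symmetric]) simp
  finally show ?thesis
    by (simp add: vec.linear_add[OF clinear_exp_contract[OF bel_z]])
qed

text \<open>The exponential fixes \<open>A $ Inl i\<close> and sends \<open>dx (Inl i)\<close> to
  \<open>dx (Inl i) + A $ Inl i\<close>, so subtracting \<open>A $ Inl i\<close> beforehand
  reproduces \<open>dx (Inl i)\<close>. It fixes \<open>dx (Inr i)\<close> because
  \<open>A $ Inr i\<close> is zero.\<close>

lemma dx_wedge_exp_contract:
  assumes "beltrami A"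
  shows "wedge (dx (Inl i)) (exp_contract A \<alpha>) =
      exp_contract A (wedge (dx (Inl i)) \<alpha> - wedge (A $ Inl i) \<alpha>)"
    and "wedge (dx (Inr i)) (exp_contract A \<alpha>) = exp_contract A (wedge (dx (Inr i)) \<alpha>)"
proof -
  have A: "contract A (A $ Inl i) = 0" "one_form (A $ Inl i)"
    using of_type_contract_beltrami(2)[of A 0 1 "A $ Inl i"] assms of_type_one_form[of 0 1]
    by (auto simp: beltrami_def)
  note dx = contract_dx[OF beltrami_one_form[OF assms]]
  show "wedge (dx (Inl i)) (exp_contract A \<alpha>) =
      exp_contract A (wedge (dx (Inl i)) \<alpha> - wedge (A $ Inl i) \<alpha>)"
    using exp_contract_wedge[OF assms one_form_dx dx A]
      exp_contract_wedge[OF assms A(2) A(1), of \<alpha>]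
    by (simp add: vec.linear_diff[OF clinear_exp_contract[OF assms]] wedge_left.add contract.zero)
  have "A $ Inr i = 0"
    using assms by (simp add: beltrami_def)
  then show "wedge (dx (Inr i)) (exp_contract A \<alpha>) = exp_contract A (wedge (dx (Inr i)) \<alpha>)"
    using exp_contract_wedge[OF assms one_form_dx dx, of "Inr i" \<alpha>] by (simp add: contract.zero)
qed

text \<open>The hypothesis \<open>integrable\<close> is the Maurer-Cartan equation of
  \<open>\<Phi>\<close>, with half the bracket written out in components.\<close>

lemma ext_d_exp_contract:
  fixes z :: "'n::{finite,linorder} cvec"
  assumes U: "open U" "z \<in> U" and bel: "\<And>y. y \<in> U \<Longrightarrow> beltrami (\<Phi> y)"
    and diff: "\<Phi> differentiable (at z)" "w differentiable (at z)"
    and integrable: "\<And>j. delbar (\<lambda>y. \<Phi> y $ Inl j) z =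
      (\<Sum>i\<in>UNIV. wedge (\<Phi> z $ Inl i) (partial_form (Inl i) (\<lambda>y. \<Phi> y $ Inl j) z))"
  shows "ext_d (\<lambda>y. exp_contract (\<Phi> y) (w y)) z =
    exp_contract (\<Phi> z) (del w z +
      (delbar w z + del (\<lambda>y. contract (\<Phi> y) (w y)) z - contract (\<Phi> z) (del w z)))"
proof -
  \<comment> \<open>The exponential sends \<open>Y a\<close> to the derivative in direction
    \<open>a\<close> of the exponential of \<open>w\<close>.\<close>
  define Y where "Y a = partial_form a w z + contract (partial_vform a \<Phi> z) (w z)" for a
  have bel_z: "beltrami (\<Phi> z)"
    using bel U(2) .
  note lin = clinear_exp_contract[OF bel_z]
  have partial: "partial_form a (\<lambda>y. exp_contract (\<Phi> y) (w y)) z = exp_contract (\<Phi> z) (Y a)" for a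
    unfolding Y_def by (rule partial_form_exp_contract[OF U bel diff])
  have "ext_d (\<lambda>y. exp_contract (\<Phi> y) (w y)) z =
      exp_contract (\<Phi> z) ((\<Sum>i\<in>UNIV. wedge (dx (Inl i)) (Y (Inl i)) - wedge (\<Phi> z $ Inl i) (Y (Inl i)))
        + (\<Sum>i\<in>UNIV. wedge (dx (Inr i)) (Y (Inr i))))"
    by (simp add: ext_d_def partial sum_UNIV_Plus dx_wedge_exp_contract[OF bel_z]
        vec.linear_add[OF lin] vec.linear_sum[OF lin])
  also have "(\<Sum>i\<in>UNIV. wedge (dx (Inl i)) (Y (Inl i)) - wedge (\<Phi> z $ Inl i) (Y (Inl i)))
        + (\<Sum>i\<in>UNIV. wedge (dx (Inr i)) (Y (Inr i))) =
      del w z + (delbar w z + del (\<lambda>y. contract (\<Phi> y) (w y)) z - contract (\<Phi> z) (del w z))"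
  proof -
    have bel': "beltrami (partial_vform a \<Phi> z)" for a
      using beltrami_partial_vform[OF U bel] .
    \<comment> \<open>Integrability makes the terms quadratic in \<open>\<Phi>\<close> cancel.\<close>
    have "(\<Sum>i\<in>UNIV. wedge (dx (Inr i)) (contract (partial_vform (Inr i) \<Phi> z) (w z))) =
        (\<Sum>i\<in>UNIV. \<Sum>j\<in>UNIV. wedge (wedge (dx (Inr i)) (partial_form (Inr i) (\<lambda>y. \<Phi> y $ Inl j) z))
          (interior_prod (Inl j) (w z)))"
      by (simp add: contract_beltrami[OF bel'] wedge_right.sum wedge_assoc partial_vform_nth)
    also have "\<dots> = (\<Sum>j\<in>UNIV. wedge (delbar (\<lambda>y. \<Phi> y $ Inl j) z) (interior_prod (Inl j) (w z)))"
      by (subst sum.swap) (simp add: delbar_def wedge_left.sum)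
    also have "\<dots> = (\<Sum>i\<in>UNIV. \<Sum>j\<in>UNIV. wedge (wedge (\<Phi> z $ Inl i) (partial_form (Inl i) (\<lambda>y. \<Phi> y $ Inl j) z))
          (interior_prod (Inl j) (w z)))"
      by (subst sum.swap) (simp add: integrable wedge_left.sum)
    also have "\<dots> = (\<Sum>i\<in>UNIV. wedge (\<Phi> z $ Inl i) (contract (partial_vform (Inl i) \<Phi> z) (w z)))"
      by (simp add: contract_beltrami[OF bel'] wedge_right.sum wedge_assoc partial_vform_nth)
    finally have key: "(\<Sum>i\<in>UNIV. wedge (dx (Inr i)) (contract (partial_vform (Inr i) \<Phi> z) (w z))) = \<dots>" .
    \<comment> \<open>The derivation rule trades the products of \<open>\<Phi> z $ Inl i\<close>
      with \<open>partial_form (Inl i) w z\<close> for \<open>contract (\<Phi> z) (del w z)\<close>;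
      the sum left over also occurs in \<open>del\<close> of the contraction and drops out of the
      difference.\<close>
    have "contract (\<Phi> z) (del w z) = (\<Sum>i\<in>UNIV. wedge (\<Phi> z $ Inl i) (partial_form (Inl i) w z)) +
        (\<Sum>i\<in>UNIV. wedge (dx (Inl i)) (contract (\<Phi> z) (partial_form (Inl i) w z)))"
      by (simp add: del_def contract.sum contract_dx_wedge[OF beltrami_one_form[OF bel_z]] sum.distrib)
    moreover have "del (\<lambda>y. contract (\<Phi> y) (w y)) z =
        (\<Sum>i\<in>UNIV. wedge (dx (Inl i)) (contract (partial_vform (Inl i) \<Phi> z) (w z))) +
        (\<Sum>i\<in>UNIV. wedge (dx (Inl i)) (contract (\<Phi> z) (partial_form (Inl i) w z)))"
      by (simp add: del_def partial_form_contract[OF diff] wedge_right.add sum.distrib)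
    ultimately show ?thesis
      by (simp add: Y_def wedge_right.add sum.distrib sum_subtractf key del_def[of w] delbar_def[of w])
  qed
  finally show ?thesis .
qed

section \<open>Passage to the frame of the nearby fibre\<close>

lemma matrix_diff_ldistrib: "A ** (B - C) = A ** B - A ** C" for A :: "'a::ring_1 ^ 'n ^ 'm"
  by (vector matrix_matrix_mult_def sum_subtractf[symmetric] algebra_simps)

lemma matrix_diff_rdistrib: "(A - B) ** C = A ** C - B ** C" for A :: "'a::ring_1 ^ 'n ^ 'm"
  by (vector matrix_matrix_mult_def sum_subtractf[symmetric] algebra_simps)

lemma matrix_inv_invertible:
  assumes "invertible A"
  shows "A ** matrix_inv A = mat 1" "matrix_inv A ** A = mat 1"
  using someI_ex[OF assms[unfolded invertible_def]] unfolding matrix_inv_def by auto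

text \<open>\<open>R\<close> intertwines the two matrices,
  \<open>R ** (mat 1 - P ** R) = (mat 1 - R ** P) ** R\<close>, hence also their inverses. The other
  identities are the equations of a left inverse \<open>N\<close> and a right inverse
  \<open>M\<close> multiplied out, with \<open>N ** R\<close> rewritten in the former.\<close>

lemma inverse_one_minus_products:
  fixes P R :: "'a::field ^ 'n ^ 'n"
  assumes "invertible (mat 1 - R ** P)" "invertible (mat 1 - P ** R)"
  defines "N \<equiv> matrix_inv (mat 1 - R ** P)" and "M \<equiv> matrix_inv (mat 1 - P ** R)"
  shows "N ** R = R ** M" and "N - (R ** M) ** P = mat 1" and "P ** (R ** M) = M - mat 1"
proof -
  note N = matrix_inv_invertible[OF assms(1), folded N_def]
  note M = matrix_inv_invertible[OF assms(2), folded M_def]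
  have "N ** R = (N ** R) ** ((mat 1 - P ** R) ** M)"
    by (simp add: M)
  also have "\<dots> = (N ** (R ** (mat 1 - P ** R))) ** M"
    by (simp only: matrix_mul_assoc)
  also have "R ** (mat 1 - P ** R) = (mat 1 - R ** P) ** R"
    by (simp add: matrix_diff_ldistrib matrix_diff_rdistrib matrix_mul_assoc)
  also have "(N ** ((mat 1 - R ** P) ** R)) ** M = ((N ** (mat 1 - R ** P)) ** R) ** M"
    by (simp only: matrix_mul_assoc)
  finally show NR: "N ** R = R ** M"
    by (simp add: N)
  show "N - (R ** M) ** P = mat 1"
    using N(2) by (simp add: matrix_diff_ldistrib matrix_mul_assoc NR)
  show "P ** (R ** M) = M - mat 1"
    using M(1) by (simp add: matrix_diff_rdistrib matrix_mul_assoc algebra_simps)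
qed

section \<open>Frames and matrices of vector-valued forms\<close>

text \<open>The frame \<open>d\<close> is an argument, so that the same matrix applies to the
  differentials of the central fibre and to the covectors of the nearby one; substitution of frames
  becomes the matrix product.\<close>

definition row_comb ::
    "('n cvec, 'n) vec \<Rightarrow> ('n \<Rightarrow> 'n ext) \<Rightarrow> 'n \<Rightarrow> 'n::{finite,linorder} ext" where
  "row_comb M d j = (\<Sum>k\<in>UNIV. M $ j $ k *s d k)"

lemma row_comb_diff: "row_comb (M - M') d j = row_comb M d j - row_comb M' d j"
  by (simp add: row_comb_def vec.scale_left_diff_distrib sum_subtractf)

lemma row_comb_one: "row_comb (mat 1) d j = d j"
proof -
  have "row_comb (mat 1) d j = (\<Sum>k\<in>UNIV. if j = k then d k else 0)"
    unfolding row_comb_def by (rule sum.cong) (auto simp: mat_def)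
  then show ?thesis
    by simp
qed

lemma row_comb_mult: "row_comb M (row_comb M' d) j = row_comb (M ** M') d j"
proof -
  have "row_comb M (row_comb M' d) j = (\<Sum>k\<in>UNIV. \<Sum>l\<in>UNIV. (M $ j $ k * M' $ k $ l) *s d l)"
    by (simp add: row_comb_def vec.scale_sum_right)
  also have "\<dots> = (\<Sum>l\<in>UNIV. (M ** M') $ j $ l *s d l)"
    by (subst sum.swap) (simp add: matrix_matrix_mult_def vec.scale_sum_left)
  finally show ?thesis
    by (simp add: row_comb_def)
qed

lemma row_comb_add: "row_comb M (\<lambda>k. d k + d' k) j = row_comb M d j + row_comb M d' j"
  by (simp add: row_comb_def vec.scale_right_distrib sum.distrib)

lemma row_comb_clinear: "clinear f \<Longrightarrow> f (row_comb M d j) = row_comb M (\<lambda>k. f (d k)) j"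
  by (simp add: row_comb_def vec.linear_sum vec.linear_scale)

lemma row_comb_dx_nth:
  assumes "inj f"
  shows "row_comb M (\<lambda>k. dx (f k)) j $ {f i} = M $ j $ i"
proof -
  have "row_comb M (\<lambda>k. dx (f k)) j $ {f i} = (\<Sum>k\<in>UNIV. if i = k then M $ j $ k else 0)"
    unfolding row_comb_def
    by (subst sum_component, rule sum.cong) (auto simp: dx_nth inj_eq[OF assms])
  then show ?thesis
    by simp
qed

lemma of_type_row_comb: "(\<And>k. of_type p q (d k)) \<Longrightarrow> of_type p q (row_comb M d j)"
  unfolding row_comb_def by (intro of_type_sum of_type_scale)

lemma vform10_nth: "vform10 M $ Inl i = row_comb M (\<lambda>k. dx (Inl k)) i" "vform10 M $ Inr i = 0"
  by (simp_all add: vform10_def row_comb_def)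

lemma vform01_nth: "vform01 M $ Inl i = 0" "vform01 M $ Inr i = row_comb M (\<lambda>k. dx (Inr k)) i"
  by (simp_all add: vform01_def row_comb_def)

definition beltrami_matrix :: "'n::{finite,linorder} vform \<Rightarrow> ('n cvec, 'n) vec" where
  "beltrami_matrix A = (\<chi> i k. A $ Inl i $ {Inr k})"

definition matrix_cnj :: "('n cvec, 'n) vec \<Rightarrow> ('n::finite cvec, 'n) vec" where
  "matrix_cnj M = (\<chi> i k. cnj (M $ i $ k))"

lemma beltrami_nth:
  "beltrami A \<Longrightarrow> A $ Inl i = row_comb (beltrami_matrix A) (\<lambda>k. dx (Inr k)) i"
  using of_type_01_expand[of "A $ Inl i"] by (simp add: beltrami_def row_comb_def beltrami_matrix_def)

text \<open>\<open>ext_cnj\<close> sums over all index sets, but a form of type (0,1) has nonzero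
  coefficients only at the sets \<open>{Inr k}\<close>.\<close>

lemma ext_cnj_01:
  assumes "of_type 0 1 u"
  shows "ext_cnj u = (\<Sum>k\<in>UNIV. cnj (u $ {Inr k}) *s dx (Inl k))"
proof -
  let ?f = "\<lambda>S. cnj (u $ S) *s wedge_list (map (\<lambda>a. dx (swap_index a)) (index_list S))"
  have "u $ S = 0" if "S \<notin> range (\<lambda>k. {Inr k})" for S
  proof (rule ccontr)
    assume "u $ S \<noteq> 0"
    then have S: "card {i. Inl i \<in> S} = 0" "card {i. Inr i \<in> S} = 1"
      using assms by (auto simp: of_type_def)
    then obtain b where "S = {b}"
      by (metis add_0 card_1_singletonE card_sum_set)
    with S that show False
      by (cases b) auto
  qed
  then have "ext_cnj u = (\<Sum>S\<in>range (\<lambda>k. {Inr k}). ?f S)"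
    unfolding ext_cnj_def subst_form_def by (intro sum.mono_neutral_cong_right) auto
  also have "\<dots> = (\<Sum>k\<in>UNIV. ?f {Inr k})"
    by (subst sum.reindex) (auto intro: injI)
  also have "\<dots> = (\<Sum>k\<in>UNIV. cnj (u $ {Inr k}) *s dx (Inl k))"
    by (simp add: index_list_def wedge_list_def swap_index_def)
  finally show ?thesis .
qed

lemma vcnj_beltrami:
  assumes "beltrami A"
  shows "vcnj A $ Inr i = row_comb (matrix_cnj (beltrami_matrix A)) (\<lambda>k. dx (Inl k)) i"
    and "vcnj A $ Inl i = 0"
    and "cobeltrami (vcnj A)"
proof -
  show 1: "vcnj A $ Inr i = row_comb (matrix_cnj (beltrami_matrix A)) (\<lambda>k. dx (Inl k)) i" for i
    using assms ext_cnj_01[of "A $ Inl i"]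
    by (simp add: vcnj_def swap_index_def beltrami_def row_comb_def matrix_cnj_def beltrami_matrix_def)
  show 2: "vcnj A $ Inl i = 0" for i
    using assms ext_cnj_01[of 0] by (simp add: vcnj_def swap_index_def beltrami_def)
  show "cobeltrami (vcnj A)"
    by (simp add: cobeltrami_def 1 2 of_type_row_comb of_type_dx[simplified])
qed

lemma contract_row_comb:
  "one_form_valued A \<Longrightarrow> contract A (row_comb M (\<lambda>k. dx (f k)) i) = row_comb M (\<lambda>k. A $ f k) i"
  by (simp add: row_comb_clinear[OF clinear_contract] contract_dx)

text \<open>Contraction acts on the form part, that is on the columns, so the matrix of the
  contracting form stands on the right.\<close>

lemma vcontract_beltrami_nth:
  assumes "beltrami A"
  shows "vcontract A (vcnj A) $ Inr i =
      row_comb (matrix_cnj (beltrami_matrix A) ** beltrami_matrix A) (\<lambda>k. dx (Inr k)) i"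
    and "vcontract (vcnj A) A $ Inl i =
      row_comb (beltrami_matrix A ** matrix_cnj (beltrami_matrix A)) (\<lambda>k. dx (Inl k)) i"
  using vcnj_beltrami[OF assms] beltrami_nth[OF assms] beltrami_one_form[OF assms]
    cobeltrami_one_form[OF vcnj_beltrami(3)[OF assms]]
  by (simp_all add: vcontract_def contract_row_comb row_comb_mult)

lemma mat01_beltrami:
  assumes "beltrami A"
  shows "mat01 (id01 - vcontract A (vcnj A)) =
    mat 1 - matrix_cnj (beltrami_matrix A) ** beltrami_matrix A"
  by (auto simp: mat01_def vcontract_beltrami_nth[OF assms] row_comb_dx_nth id01_def dx_nth mat_def
      vec_eq_iff)

lemma mat10_beltrami:
  assumes "beltrami A"
  shows "mat10 (id10 - vcontract (vcnj A) A) =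
    mat 1 - beltrami_matrix A ** matrix_cnj (beltrami_matrix A)"
  by (auto simp: mat10_def vcontract_beltrami_nth[OF assms] row_comb_dx_nth id10_def dx_nth mat_def
      vec_eq_iff)

text \<open>A number operator: each basis element is an eigenvector whose eigenvalue counts its
  factors \<open>dx (f i)\<close>. With \<open>Inr\<close> it expands forms of type (p,1), with
  \<open>Inl\<close> it yields the multiple \<open>q\<close> of forms of type (q,0).\<close>

lemma sum_dx_wedge_interior:
  fixes f :: "'i::finite \<Rightarrow> 'n::{finite,linorder} + 'n"
  assumes "\<And>S. \<alpha> $ S \<noteq> 0 \<Longrightarrow> card {i. f i \<in> S} = p"
  shows "(\<Sum>i\<in>UNIV. wedge (dx (f i)) (interior_prod (f i) \<alpha>)) = of_nat p *s \<alpha>"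
proof -
  define L where "L \<beta> = (\<Sum>i\<in>UNIV. wedge (dx (f i)) (interior_prod (f i) \<beta>))" for \<beta>
  have lin: "clinear L"
    by (rule clinearI)
       (simp_all add: L_def interior.add interior.scale wedge_right.add wedge_right.scale
          sum.distrib vec.scale_sum_right)
  have axis: "L (axis S 1) = of_nat (card {i. f i \<in> S}) *s axis S 1" for S
  proof -
    \<comment> \<open>Removing \<open>f i\<close> and putting \<open>dx (f i)\<close> back give the
      same sign twice.\<close>
    have "L (axis S 1) = (\<Sum>i\<in>UNIV. if f i \<in> S then axis S 1 else 0)"
      unfolding L_def
      by (intro sum.cong)
         (auto simp: interior_axis wedge_right.scale dx_wedge_axis insert_absorb wedge_right.zero)
    also have "\<dots> = (\<Sum>i | f i \<in> S. axis S 1)"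
      by (rule sum.mono_neutral_cong_right) auto
    finally show ?thesis
      by (simp only: vec.sum_constant_scale)
  qed
  have "L \<alpha> = L (\<Sum>S\<in>UNIV. \<alpha> $ S *s axis S 1)"
    by (simp only: basis_expansion)
  also have "\<dots> = (\<Sum>S\<in>UNIV. \<alpha> $ S *s (of_nat (card {i. f i \<in> S}) *s axis S 1))"
    by (simp add: vec.linear_sum[OF lin] vec.linear_scale[OF lin] axis)
  also have "\<dots> = (\<Sum>S\<in>UNIV. of_nat p *s (\<alpha> $ S *s axis S 1))"
  proof (rule sum.cong)
    fix S
    show "\<alpha> $ S *s (of_nat (card {i. f i \<in> S}) *s axis S 1) = of_nat p *s (\<alpha> $ S *s axis S 1)"
      using assms[of S] by (cases "\<alpha> $ S = 0") (simp_all add: mult.commute)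
  qed simp
  also have "\<dots> = of_nat p *s \<alpha>"
    by (simp only: vec.scale_sum_right[symmetric] basis_expansion)
  finally show ?thesis
    by (simp add: L_def)
qed

section \<open>The extension map in conjugate degree at most one\<close>

lemma parity_exp_contract:
  assumes "beltrami (A :: 'n::{finite,linorder} vform)"
  shows "parity (exp_contract A \<alpha>) = exp_contract A (parity \<alpha>)"
proof -
  have "parity ((contract A ^^ k) \<alpha>) = (contract A ^^ k) (parity \<alpha>)" for k
    by (induction k) (simp_all add: parity_contract[OF beltrami_one_form[OF assms]])
  then show ?thesis
    by (simp add: exp_contract_beltrami[OF assms lessI] parity.sum parity.scale del: sum.lessThan_Suc)
qed

text \<open>These are the values of the conjugate exponential that enter \<open>ext_map\<close> on
  forms of type (p,0) and (p,1). A second contraction vanishes because \<open>A $ Inr k\<close> has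
  type (1,0).\<close>

lemma exp_contract_cobeltrami:
  assumes "cobeltrami A"
  shows "exp_contract A ext_one = ext_one"
    and "exp_contract A (dx (Inr k)) = dx (Inr k) + A $ Inr k"
proof -
  have suc: "(contract A ^^ Suc n) \<alpha> = (contract A ^^ n) (contract A \<alpha>)" for n \<alpha>
    by (simp add: funpow_Suc_right del: funpow.simps)
  have zero: "(contract A ^^ n) 0 = 0" for n
    by (rule vec.linear_0[OF clinear_funpow[OF clinear_contract]])
  have "(contract A ^^ n) ext_one = 0" if n: "n \<ge> 1" for n
  proof -
    obtain m where "n = Suc m"
      using n by (cases n) auto
    then show ?thesis
      by (simp only: suc contract_one zero)
  qed
  then show "exp_contract A ext_one = ext_one"
    using exp_contract_finite[of 1 A ext_one] by simp
  have dx: "contract A (dx (Inr k)) = A $ Inr k" "contract A (A $ Inr k) = 0"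
    using assms contract_dx[OF cobeltrami_one_form[OF assms]] contract_cobeltrami_zero[OF assms]
    by (auto simp: cobeltrami_def)
  have "(contract A ^^ n) (dx (Inr k)) = 0" if n: "n \<ge> 2" for n
  proof -
    obtain m where "n = Suc (Suc m)"
      using that[of "n - 2"] n by simp
    then show ?thesis
      by (simp only: suc dx zero)
  qed
  then show "exp_contract A (dx (Inr k)) = dx (Inr k) + A $ Inr k"
    using exp_contract_finite[of 2 A "dx (Inr k)"] by (simp add: numeral_2_eq_2 dx)
qed

lemma clinear_ext_map: "clinear (ext_map A)"
  by (rule clinearI)
     (simp_all add: ext_map_def vec.scale_left_distrib sum.distrib vec.scale_sum_right)

lemma ext_map_axis:
  "ext_map A (axis S 1) = wedge (exp_contract A (axis (S \<inter> range Inl) 1))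
    (exp_contract (vcnj A) (axis (S \<inter> range Inr) 1))"
proof -
  have "ext_map A (axis S 1) = (\<Sum>T\<in>UNIV. if S = T then
      wedge (exp_contract A (axis (T \<inter> range Inl) 1))
        (exp_contract (vcnj A) (axis (T \<inter> range Inr) 1)) else 0)"
    unfolding ext_map_def by (rule sum.cong) (auto simp: axis_def)
  then show ?thesis
    by simp
qed

lemma of_type_0_support:
  assumes "of_type p 0 \<alpha>" "\<alpha> $ S \<noteq> 0"
  shows "S \<inter> range Inr = {}" "S \<inter> range Inl = S"
proof -
  have "Inr i \<notin> S" for i
    using assms by (auto simp: of_type_def)
  then show "S \<inter> range Inr = {}" "S \<inter> range Inl = S"
    by (auto, metis rangeI sum.exhaust)
qed

text \<open>Variant of \<open>clinear_eqI\<close> for maps compared only on products of holomorphic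
  differentials.\<close>

lemma clinear_eqI_of_type_0:
  assumes "of_type p 0 \<alpha>" "clinear f" "clinear g"
    and "\<And>S. S \<inter> range Inr = {} \<Longrightarrow> S \<inter> range Inl = S \<Longrightarrow> f (axis S 1) = g (axis S 1)"
  shows "f \<alpha> = g \<alpha>"
proof -
  have "f \<alpha> = f (\<Sum>S\<in>UNIV. \<alpha> $ S *s axis S 1)"
    by (simp only: basis_expansion)
  also have "\<dots> = (\<Sum>S\<in>UNIV. \<alpha> $ S *s f (axis S 1))"
    by (simp add: vec.linear_sum[OF assms(2)] vec.linear_scale[OF assms(2)])
  also have "\<dots> = (\<Sum>S\<in>UNIV. \<alpha> $ S *s g (axis S 1))"
  proof (rule sum.cong)
    fix S
    show "\<alpha> $ S *s f (axis S 1) = \<alpha> $ S *s g (axis S 1)"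
      using of_type_0_support[OF assms(1)] assms(4) by (cases "\<alpha> $ S = 0") simp_all
  qed simp
  also have "\<dots> = g (\<Sum>S\<in>UNIV. \<alpha> $ S *s axis S 1)"
    by (simp add: vec.linear_sum[OF assms(3)] vec.linear_scale[OF assms(3)])
  finally show ?thesis
    by (simp only: basis_expansion)
qed

text \<open>The second factor of \<open>ext_map\<close> is here the exponential of
  \<open>ext_one\<close>, which is \<open>ext_one\<close>.\<close>

lemma ext_map_of_type_0:
  assumes "beltrami A" "of_type p 0 \<alpha>"
  shows "ext_map A \<alpha> = exp_contract A \<alpha>"
  using exp_contract_cobeltrami(1)[OF vcnj_beltrami(3)[OF assms(1)]]
  by (intro clinear_eqI_of_type_0[OF assms(2) clinear_ext_map clinear_exp_contract[OF assms(1)]])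
     (simp add: ext_map_axis flip: ext_one_def)

text \<open>\<open>ext_map\<close> expects the conjugate differentials last. Moving
  \<open>dx (Inr k)\<close> there and moving its image back cost the same sign, as the exponential
  preserves parity.\<close>

lemma ext_map_dx_wedge:
  assumes "beltrami A" "of_type p 0 \<alpha>"
  shows "ext_map A (wedge (dx (Inr k)) \<alpha>) = wedge (dx (Inr k) + vcnj A $ Inr k) (exp_contract A \<alpha>)"
proof (rule clinear_eqI_of_type_0[OF assms(2)])
  note co = vcnj_beltrami(3)[OF assms(1)]
  note lin = clinear_exp_contract[OF assms(1)]
  show "clinear (\<lambda>\<alpha>. ext_map A (wedge (dx (Inr k)) \<alpha>))"
    by (rule clinearI) (simp_all add: wedge_right.add wedge_right.scale
        vec.linear_add[OF clinear_ext_map] vec.linear_scale[OF clinear_ext_map])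
  show "clinear (\<lambda>\<alpha>. wedge (dx (Inr k) + vcnj A $ Inr k) (exp_contract A \<alpha>))"
    by (rule clinearI) (simp_all add: wedge_right.add wedge_right.scale
        vec.linear_add[OF lin] vec.linear_scale[OF lin])
  fix S :: "('a + 'a) set"
  assume S: "S \<inter> range Inr = {}" "S \<inter> range Inl = S"
  let ?e = "dx (Inr k) + vcnj A $ Inr k"
  have e: "one_form ?e"
    using one_form_dx cobeltrami_one_form[OF co] by (intro one_form_add) auto
  have nin: "Inr k \<notin> S"
    using S(1) by auto
  \<comment> \<open>All elements of \<open>S\<close> have the form \<open>Inl i\<close> and precede
    \<open>Inr k\<close>, so there is no inversion.\<close>
  have "\<not> index_less (Inr k) x" if "x \<in> S" for x
    using S(2) that by (cases x) auto
  then have "{(a, b). a \<in> S \<and> b \<in> {Inr k} \<and> index_less b a} = {}"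
    by auto
  then have "shuffle_sign S {Inr k} = 1"
    by (simp only: shuffle_sign_def card.empty power_0)
  then have "wedge (dx (Inr k)) (axis S 1) = (- 1) ^ card S *s axis (insert (Inr k) S) 1"
    using nin shuffle_sign_swap[OF nin] by (simp add: dx_wedge_axis)
  moreover have "insert (Inr k) S \<inter> range Inl = S" "insert (Inr k) S \<inter> range Inr = {Inr k}"
    using S by auto
  then have "ext_map A (axis (insert (Inr k) S) 1) = wedge (exp_contract A (axis S 1)) ?e"
    by (simp only: ext_map_axis exp_contract_cobeltrami[OF co] flip: dx_def)
  ultimately have "ext_map A (wedge (dx (Inr k)) (axis S 1)) =
      (- 1) ^ card S *s wedge (exp_contract A (axis S 1)) ?e"
    by (simp add: vec.linear_scale[OF clinear_ext_map])
  also have "\<dots> = wedge (parity (exp_contract A (axis S 1))) ?e"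
    by (simp add: parity_exp_contract[OF assms(1)] parity_axis vec.linear_scale[OF lin] wedge_left.scale)
  also have "\<dots> = wedge ?e (exp_contract A (axis S 1))"
    by (rule one_form_wedge_parity[OF e, symmetric])
  finally show "ext_map A (wedge (dx (Inr k)) (axis S 1)) = wedge ?e (exp_contract A (axis S 1))" .
qed

section \<open>Rewriting the exponential through the extension map\<close>

lemma exp_contract_dx_wedge:
  assumes "beltrami A"
  shows "exp_contract A (wedge (dx (Inl k)) \<alpha>) = wedge (dx (Inl k) + A $ Inl k) (exp_contract A \<alpha>)"
  using assms of_type_contract_beltrami(2)[of A 0 1 "A $ Inl k"] beltrami_one_form[OF assms]
  by (intro exp_contract_wedge) (auto simp: contract_dx beltrami_def)

text \<open>\<open>\<beta>\<close> is the sum of the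
  \<open>wedge (dx (Inr j)) (interior_prod (Inr j) \<beta>)\<close>. The exponential fixes
  \<open>dx (Inr j)\<close>, which is then written in the frame of the nearby fibre, where each term
  is a value of \<open>ext_map\<close>.\<close>

lemma exp_contract_eq_ext_map:
  assumes bel: "beltrami A" and type: "of_type p 1 \<beta>"
    and inv01: "invertible (mat01 (id01 - vcontract A (vcnj A)))"
    and inv10: "invertible (mat10 (id10 - vcontract (vcnj A) A))"
  defines "B \<equiv> vcontract (inv10 (id10 - vcontract (vcnj A) A)) (vcnj A)"
  shows "exp_contract A \<beta> =
      ext_map A (contract (inv01 (id01 - vcontract A (vcnj A))) \<beta> - contract B \<beta>)"
    and "of_type q 0 \<eta> \<Longrightarrow> contract B (contract A \<eta>) =
      contract (inv10 (id10 - vcontract (vcnj A) A)) \<eta> - of_nat q *s \<eta>"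
proof -
  define P R where "P = beltrami_matrix A" and "R = matrix_cnj P"
  define N M where "N = matrix_inv (mat 1 - R ** P)" and "M = matrix_inv (mat 1 - P ** R)"
  have N: "inv01 (id01 - vcontract A (vcnj A)) = vform01 N"
    by (simp add: inv01_def mat01_beltrami[OF bel] N_def P_def R_def)
  have M: "inv10 (id10 - vcontract (vcnj A) A) = vform10 M"
    by (simp add: inv10_def mat10_beltrami[OF bel] M_def P_def R_def)
  note inverse = inverse_one_minus_products[of R P, folded N_def M_def]
  have inverse: "N ** R = R ** M" "N - (R ** M) ** P = mat 1" "P ** (R ** M) = M - mat 1"
    using inverse inv01 inv10 unfolding mat01_beltrami[OF bel] mat10_beltrami[OF bel]
    by (auto simp: P_def R_def)
  let ?dz = "\<lambda>k. dx (Inl k)" and ?dzb = "\<lambda>k. dx (Inr k)"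
  have A: "A $ Inl i = row_comb P ?dzb i" for i
    using beltrami_nth[OF bel] by (simp add: P_def)
  have Ac: "vcnj A $ Inr i = row_comb R ?dz i" "vcnj A $ Inl i = 0" for i
    using vcnj_beltrami[OF bel] by (simp_all add: P_def R_def)
  have "one_form (row_comb M ?dz i)" for i
    by (rule of_type_one_form[of 1 0], rule of_type_row_comb) (simp_all add: of_type_dx[simplified])
  then have "one_form_valued (vform10 M)"
    unfolding all_sum vform10_nth by auto
  then have B: "B $ Inr i = row_comb (R ** M) ?dz i" "B $ Inl i = 0" for i
    unfolding B_def M
    by (simp_all add: vcontract_def Ac contract_row_comb vform10_nth row_comb_mult contract.zero)
  have coB: "cobeltrami B"
    by (simp add: cobeltrami_def B of_type_row_comb of_type_dx[simplified])
  have contract01: "contract (vform01 N) \<beta> =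
      (\<Sum>j\<in>UNIV. wedge (row_comb N ?dzb j) (interior_prod (Inr j) \<beta>))"
    by (simp add: contract_def sum_UNIV_Plus vform01_nth wedge_left.zero)
  define E where "E j = exp_contract A (interior_prod (Inr j) \<beta>)" for j
  have X: "of_type p 0 (interior_prod (Inr j) \<beta>)" for j
    using of_type_interior_Inr(1)[OF type] by simp
  have zbar: "ext_map A (wedge (row_comb N ?dzb j) (interior_prod (Inr j) \<beta>)) =
      wedge (row_comb N (\<lambda>k. ?dzb k + vcnj A $ Inr k) j) (E j)" for j
    by (simp add: row_comb_clinear[OF clinear_ext_map] ext_map_dx_wedge[OF bel X]
        row_comb_clinear[OF clinear_wedge_left] E_def)
  \<comment> \<open>Wedging with \<open>dx (Inl k)\<close> keeps the conjugate degree zero, where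
    \<open>ext_map\<close> agrees with the exponential.\<close>
  have "of_type (1 + p) (0 + 0) (wedge (?dz k) (interior_prod (Inr j) \<beta>))" for j k
    by (intro of_type_wedge X of_type_dx)
  then have "ext_map A (wedge (?dz k) (interior_prod (Inr j) \<beta>)) =
      wedge (?dz k + A $ Inl k) (E j)" for j k
    using ext_map_of_type_0[OF bel, of "Suc p"] exp_contract_dx_wedge[OF bel] by (simp add: E_def)
  then have z: "ext_map A (wedge (row_comb (R ** M) ?dz j) (interior_prod (Inr j) \<beta>)) =
      wedge (row_comb (R ** M) (\<lambda>k. ?dz k + A $ Inl k) j) (E j)" for j
    by (simp add: row_comb_clinear[OF clinear_ext_map]
        row_comb_clinear[OF clinear_wedge_left])
  \<comment> \<open>Solves the frame equations for \<open>dx (Inr j)\<close>: the holomorphic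
    differentials get the coefficients \<open>N ** R - R ** M = 0\<close>, the conjugate ones
    \<open>N - (R ** M) ** P = mat 1\<close>.\<close>
  have frame: "row_comb N (\<lambda>k. ?dzb k + vcnj A $ Inr k) j -
      row_comb (R ** M) (\<lambda>k. ?dz k + A $ Inl k) j = ?dzb j" for j
  proof -
    have "row_comb N (\<lambda>k. ?dzb k + vcnj A $ Inr k) j - row_comb (R ** M) (\<lambda>k. ?dz k + A $ Inl k) j =
        row_comb (N - (R ** M) ** P) ?dzb j + row_comb (N ** R - R ** M) ?dz j"
      by (simp add: A Ac row_comb_add row_comb_mult row_comb_diff)
    then show ?thesis
      by (simp only: inverse row_comb_one row_comb_diff) simp
  qed
  have "exp_contract A \<beta> = exp_contract A (\<Sum>j\<in>UNIV. wedge (?dzb j) (interior_prod (Inr j) \<beta>))"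
    using type by (subst sum_dx_wedge_interior[where p = 1]) (auto simp: of_type_def)
  also have "\<dots> = (\<Sum>j\<in>UNIV. wedge (?dzb j) (E j))"
    by (simp add: vec.linear_sum[OF clinear_exp_contract[OF bel]] dx_wedge_exp_contract(2)[OF bel] E_def)
  also have "\<dots> = (\<Sum>j\<in>UNIV. wedge (row_comb N (\<lambda>k. ?dzb k + vcnj A $ Inr k) j -
      row_comb (R ** M) (\<lambda>k. ?dz k + A $ Inl k) j) (E j))"
    by (simp only: frame)
  also have "\<dots> = ext_map A (contract (vform01 N) \<beta> - contract B \<beta>)"
    by (simp add: contract01 contract_cobeltrami[OF coB] B vec.linear_sum[OF clinear_ext_map]
        vec.linear_diff[OF clinear_ext_map] zbar z wedge_left.diff sum_subtractf)
  finally show "exp_contract A \<beta> =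
      ext_map A (contract (inv01 (id01 - vcontract A (vcnj A))) \<beta> - contract B \<beta>)"
    by (simp only: N)

  assume \<eta>: "of_type q 0 \<eta>"
  note B1 = cobeltrami_one_form[OF coB] and A1 = beltrami_one_form[OF bel]
  \<comment> \<open>\<open>B\<close> kills the holomorphic factor and turns the matrix
    \<open>P\<close> of \<open>A\<close> into \<open>P ** (R ** M) = M - mat 1\<close>.\<close>
  have "contract B (wedge (A $ Inl i) (interior_prod (Inl i) \<eta>)) =
      wedge (row_comb M ?dz i - ?dz i) (interior_prod (Inl i) \<eta>)" for i
  proof -
    have "contract B (A $ Inl i) = row_comb M ?dz i - ?dz i"
      by (simp add: A contract_row_comb[OF B1] B row_comb_mult inverse row_comb_diff row_comb_one)
    moreover have "contract B (interior_prod (Inl i) \<eta>) = 0"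
      by (rule contract_cobeltrami_zero[OF coB of_type_interior_Inl(1)[OF \<eta>]])
    ultimately show ?thesis
      using A1 by (simp add: contract_wedge[OF B1] wedge_right.zero)
  qed
  then have "contract B (contract A \<eta>) =
      (\<Sum>i\<in>UNIV. wedge (row_comb M ?dz i) (interior_prod (Inl i) \<eta>)) -
      (\<Sum>i\<in>UNIV. wedge (?dz i) (interior_prod (Inl i) \<eta>))"
    by (simp add: contract_beltrami[OF bel] contract.sum wedge_left.diff sum_subtractf)
  also have "(\<Sum>i\<in>UNIV. wedge (?dz i) (interior_prod (Inl i) \<eta>)) = of_nat q *s \<eta>"
    using \<eta> by (intro sum_dx_wedge_interior) (auto simp: of_type_def)
  finally show "contract B (contract A \<eta>) =
      contract (inv10 (id10 - vcontract (vcnj A) A)) \<eta> - of_nat q *s \<eta>"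
    by (simp add: M contract_def sum_UNIV_Plus vform10_nth wedge_left.zero)
qed

text \<open>The bidegrees are treated separately: on \<open>\<eta>\<close> the exponential is
  already \<open>ext_map\<close>, and the rest has type (p,1).\<close>

lemma exp_contract_add_eq_ext_map:
  assumes bel: "beltrami A" and \<eta>: "of_type (Suc p) 0 \<eta>" and \<gamma>: "of_type p 1 \<gamma>"
    and inv: "invertible (mat01 (id01 - vcontract A (vcnj A)))"
      "invertible (mat10 (id10 - vcontract (vcnj A) A))"
  defines "inv_01 \<equiv> inv01 (id01 - vcontract A (vcnj A))"
    and "inv_10 \<equiv> inv10 (id10 - vcontract (vcnj A) A)"
  shows "exp_contract A (\<eta> + (\<gamma> - contract A \<eta>)) =
    ext_map A (contract inv_01 (\<gamma> - contract A \<eta>) + contract inv_10 \<eta> - of_nat p *s \<eta>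
      - contract (vcontract inv_10 (vcnj A)) \<gamma>)"
proof -
  let ?B = "vcontract inv_10 (vcnj A)"
  have type: "of_type p 1 (\<gamma> - contract A \<eta>)"
    using of_type_contract_beltrami(1)[OF bel \<eta>] \<gamma> by (auto intro: of_type_diff)
  note eq = exp_contract_eq_ext_map[OF bel type inv, folded inv_01_def inv_10_def]
  have "exp_contract A (\<eta> + (\<gamma> - contract A \<eta>)) =
      ext_map A (\<eta> + (contract inv_01 (\<gamma> - contract A \<eta>) - contract ?B (\<gamma> - contract A \<eta>)))"
    unfolding vec.linear_add[OF clinear_exp_contract[OF bel]] vec.linear_add[OF clinear_ext_map]
      ext_map_of_type_0[OF bel \<eta>] eq(1) ..
  also have "\<eta> + (contract inv_01 (\<gamma> - contract A \<eta>) - contract ?B (\<gamma> - contract A \<eta>)) =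
      contract inv_01 (\<gamma> - contract A \<eta>) + contract inv_10 \<eta> - of_nat p *s \<eta> - contract ?B \<gamma>"
  proof -
    have "contract ?B (\<gamma> - contract A \<eta>) =
        contract ?B \<gamma> - (contract inv_10 \<eta> - of_nat (Suc p) *s \<eta>)"
      using eq(2)[OF \<eta>] by (simp only: contract.diff)
    \<comment> \<open>The number operator contributes \<open>- (p + 1)\<close> times
      \<open>\<eta>\<close>; together with the summand \<open>\<eta>\<close> this leaves the factor
      \<open>- p\<close> of the formula.\<close>
    moreover have "of_nat (Suc p) *s \<eta> = of_nat p *s \<eta> + \<eta>"
      by (simp add: vec.scale_left_distrib)
    ultimately show ?thesis
      by simp
  qed
  finally show ?thesis .
qed

section \<open>The formula in a chart\<close>

theorem proposition1p6:
  fixes X :: "'x topology"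
    and A :: "('x, 'm::finite cvec) chart set"
    and \<pi> :: "'x \<Rightarrow> complex"
    and r :: real
    and C :: "complex \<Rightarrow> ('x, 'n::{finite,linorder} cvec) chart set"
    and F :: "'x \<times> complex \<Rightarrow> 'x"
    and \<phi> :: "complex \<Rightarrow> ('x, 'n) vector_form"
    and t :: complex
    and p :: nat
    and \<omega> :: "('x, 'n) form"
  assumes "holomorphic_family X A \<pi> r C"
    and "transversely_holomorphic_trivialization X A \<pi> r C F"
    and "kuranishi_data r C F \<phi>"
    and "t \<in> ball 0 r"
    and "\<And>c z. c \<in> C 0 \<Longrightarrow> z \<in> chart_range c \<Longrightarrow>
           invertible (mat01 (id01 - vcontract (\<phi> t c z) (vcnj (\<phi> t c z)))) \<and>
           invertible (mat10 (id10 - vcontract (vcnj (\<phi> t c z)) (\<phi> t c z)))"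
    and "\<omega> \<in> forms (C 0) p 0"
  shows "\<forall>c\<in>C 0. \<forall>z\<in>chart_range c.
    (let \<Phi> = \<phi> t c; w = \<omega> c;
         inv_01 = inv01 (id01 - vcontract (\<Phi> z) (vcnj (\<Phi> z)));
         inv_10 = inv10 (id10 - vcontract (vcnj (\<Phi> z)) (\<Phi> z))
     in ext_d (\<lambda>y. ext_map (\<Phi> y) (w y)) z =
        ext_map (\<Phi> z)
          (contract inv_01
             (delbar w z + del (\<lambda>y. contract (\<Phi> y) (w y)) z - contract (\<Phi> z) (del w z))
           + contract inv_10 (del w z)
           - of_nat p *s del w z
           - contract (vcontract inv_10 (vcnj (\<Phi> z)))
               (delbar w z + del (\<lambda>y. contract (\<Phi> y) (w y)) z)))"
proof (intro ballI)
  fix c z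
  assume c: "c \<in> C 0" and z: "z \<in> chart_range c"
  define \<Phi> w where "\<Phi> = \<phi> t c" and "w = \<omega> c"
  define U where "U = chart_range c"
  have "C 0 = fibre_charts X A \<pi> 0"
    using assms(1) by (simp add: holomorphic_family_def)
  then have U: "open U" "z \<in> U"
    using c z by (auto simp: fibre_charts_def top_chart_def U_def)
  have "\<phi> t \<in> beltrami_forms (C 0)"
    using assms(3,4) by (simp add: kuranishi_data_def)
  then have \<Phi>: "smooth_on U \<Phi>" and bel: "beltrami (\<Phi> y)" if "y \<in> U" for y
    using c that by (auto simp: beltrami_forms_def beltrami_def U_def \<Phi>_def)
  have w: "smooth_on U w" and w_type: "of_type p 0 (w y)" if "y \<in> U" for y
    using assms(6) c that by (auto simp: forms_def U_def w_def)
  have smooth: "f differentiable (at z)" if "smooth_on U f" for f :: "'n cvec \<Rightarrow> 'e::euclidean_space"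
    using that U(2) by (metis Ck_on.simps(2) smooth_on_def)
  note diff = smooth[OF \<Phi>[OF U(2)]] smooth[OF w[OF U(2)]]
  have integrable: "delbar (\<lambda>y. \<Phi> y $ Inl j) z =
      (\<Sum>i\<in>UNIV. wedge (\<Phi> z $ Inl i) (partial_form (Inl i) (\<lambda>y. \<Phi> y $ Inl j) z))" for j
  proof -
    have "vdelbar \<Phi> z = (1 / 2) *\<^sub>R bracket \<Phi> \<Phi> z"
      using assms(3,4) c z by (auto simp: kuranishi_data_def \<Phi>_def)
    then have "vdelbar \<Phi> z $ Inl j = (1 / 2) *\<^sub>R bracket \<Phi> \<Phi> z $ Inl j"
      by simp
    \<comment> \<open>For equal arguments the two summands of the bracket coincide, and the factor
      1/2 absorbs the doubling.\<close>
    then show ?thesis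
      by (simp add: vdelbar_def bracket_def sum.distrib scaleR_sum_right flip: scaleR_2)
  qed
  have partial: "of_type p 0 (partial_form a w z)" for a
    using of_type_partial_form[OF U w_type] .
  have "of_type (1 + p) (0 + 0) (wedge (dx (Inl i)) (partial_form (Inl i) w z))" for i
    by (intro of_type_wedge of_type_dx partial)
  then have del_w: "of_type (Suc p) 0 (del w z)"
    unfolding del_def by (intro of_type_sum) simp
  have "of_type (0 + p) (1 + 0) (wedge (dx (Inr i)) (partial_form (Inr i) w z))" for i
    by (intro of_type_wedge of_type_dx partial)
  then have delbar_w: "of_type p 1 (delbar w z)"
    unfolding delbar_def by (intro of_type_sum) simp
  have del_contract: "of_type p 1 (del (\<lambda>y. contract (\<Phi> y) (w y)) z)"
  \<comment> \<open>For \<open>p = 0\<close> the truncated degree \<open>p - 1\<close> would be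
    wrong, but then the contraction vanishes on all of \<open>U\<close>.\<close>
  proof (cases "p = 0")
    case True
    then have "contract (\<Phi> y) (w y) = 0" if "y \<in> U" for y
      using of_type_contract_beltrami(2)[OF bel w_type] that by auto
    then have "partial_form a (\<lambda>y. contract (\<Phi> y) (w y)) z = 0" for a
      using partial_form_cong[OF U, of "\<lambda>y. contract (\<Phi> y) (w y)" "\<lambda>y. 0" a]
      by (simp add: partial_form_zero)
    then show ?thesis
      by (simp add: del_def wedge_right.zero)
  next
    case False
    then have "of_type (p - 1) 1 (contract (\<Phi> y) (w y))" if "y \<in> U" for y
      using of_type_contract_beltrami(1)[OF bel w_type] that by auto
    then have "of_type (p - 1) 1 (partial_form a (\<lambda>y. contract (\<Phi> y) (w y)) z)" for a
      by (rule of_type_partial_form[OF U])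
    then have "of_type (1 + (p - 1)) (0 + 1)
        (wedge (dx (Inl i)) (partial_form (Inl i) (\<lambda>y. contract (\<Phi> y) (w y)) z))" for i
      by (intro of_type_wedge of_type_dx)
    then show ?thesis
      using False unfolding del_def by (intro of_type_sum) simp
  qed
  \<comment> \<open>\<open>ext_d\<close> differentiates, so the two maps have to agree on the
    neighbourhood \<open>U\<close>, not just at \<open>z\<close>.\<close>
  have "ext_d (\<lambda>y. ext_map (\<Phi> y) (w y)) z = ext_d (\<lambda>y. exp_contract (\<Phi> y) (w y)) z"
    by (rule ext_d_cong[OF U]) (rule ext_map_of_type_0[OF bel w_type])
  also have "\<dots> = exp_contract (\<Phi> z) (del w z +
      (delbar w z + del (\<lambda>y. contract (\<Phi> y) (w y)) z - contract (\<Phi> z) (del w z)))"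
    by (rule ext_d_exp_contract[OF U bel diff integrable])
  also have "\<dots> = ext_map (\<Phi> z)
      (contract (inv01 (id01 - vcontract (\<Phi> z) (vcnj (\<Phi> z))))
         (delbar w z + del (\<lambda>y. contract (\<Phi> y) (w y)) z - contract (\<Phi> z) (del w z))
       + contract (inv10 (id10 - vcontract (vcnj (\<Phi> z)) (\<Phi> z))) (del w z)
       - of_nat p *s del w z
       - contract (vcontract (inv10 (id10 - vcontract (vcnj (\<Phi> z)) (\<Phi> z))) (vcnj (\<Phi> z)))
           (delbar w z + del (\<lambda>y. contract (\<Phi> y) (w y)) z))"
    by (rule exp_contract_add_eq_ext_map[OF bel[OF U(2)] del_w of_type_add[OF delbar_w del_contract]])
       (use assms(5)[OF c z] in \<open>simp_all add: \<Phi>_def\<close>)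
  finally show "let \<Phi> = \<phi> t c; w = \<omega> c;
         inv_01 = inv01 (id01 - vcontract (\<Phi> z) (vcnj (\<Phi> z)));
         inv_10 = inv10 (id10 - vcontract (vcnj (\<Phi> z)) (\<Phi> z))
     in ext_d (\<lambda>y. ext_map (\<Phi> y) (w y)) z =
        ext_map (\<Phi> z)
          (contract inv_01
             (delbar w z + del (\<lambda>y. contract (\<Phi> y) (w y)) z - contract (\<Phi> z) (del w z))
           + contract inv_10 (del w z)
           - of_nat p *s del w z
           - contract (vcontract inv_10 (vcnj (\<Phi> z)))
               (delbar w z + del (\<lambda>y. contract (\<Phi> y) (w y)) z))"
    by (simp only: Let_def \<Phi>_def w_def)
qed

end
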